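(* Let $\beta:M_n(\mathbb C)\to M_m(\mathbb C)$ be a completely positive trace preserving map with Hilbert–Schmidt adjoint $\beta^*$, and let $f:[0,\infty)\to(0,\infty)$ be operator monotone. Assume $D_1,D_2\in M_n(\mathbb C)$ and $\beta(D_1),\beta(D_2)$ are positive definite. Then, as operators on $M_n(\mathbb C)$, $$\beta^*\big(\mathbb J^f_{\beta(D_1),\beta(D_2)}\big)^{-1}\beta\ \le\ \big(\mathbb J^f_{D_1,D_2}\big)^{-1}.$$
   Context: Matrix spaces $M_k(\mathbb C)$ are Hilbert spaces with $\langle B,C\rangle=\mathrm{Tr}\,B^*C$, and operator inequalities refer to this inner product. For positive definite $D_1,D_2\in M_k(\mathbb C)$, $\mathbb L_{D_1}X=D_1X$, $\mathbb R_{D_2}X=XD_2$ and $\mathbb J^f_{D_1,D_2}=f(\mathbb L_{D_1}\mathbb R_{D_2}^{-1})\mathbb R_{D_2}$ (functional calculus of commuting positive operators), which is positive and invertible since $f>0$. *)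

theory Defs
  imports "Jordan_Normal_Form.Matrix"
begin

definition cadj :: "complex mat \<Rightarrow> complex mat" where
  "cadj A = mat (dim_col A) (dim_row A) (\<lambda>(i,j). cnj (A $$ (j,i)))"

definition mtrace :: "complex mat \<Rightarrow> complex" where
  "mtrace A = (\<Sum>i<dim_row A. A $$ (i,i))"

definition hs_inner :: "complex mat \<Rightarrow> complex mat \<Rightarrow> complex" where
  "hs_inner B C = mtrace (cadj B * C)"

definition hermitian :: "complex mat \<Rightarrow> bool" where
  "hermitian A \<longleftrightarrow> cadj A = A"

definition qform :: "complex mat \<Rightarrow> complex vec \<Rightarrow> complex" where
  "qform A v = (\<Sum>i<dim_vec v. cnj (v $ i) * (A *\<^sub>v v) $ i)"

definition psd_mat :: "nat \<Rightarrow> complex mat \<Rightarrow> bool" where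
  "psd_mat k A \<longleftrightarrow> A \<in> carrier_mat k k \<and> hermitian A \<and>
     (\<forall>v \<in> carrier_vec k. 0 \<le> Re (qform A v))"

definition pd_mat :: "nat \<Rightarrow> complex mat \<Rightarrow> bool" where
  "pd_mat k A \<longleftrightarrow> A \<in> carrier_mat k k \<and> hermitian A \<and>
     (\<forall>v \<in> carrier_vec k. v \<noteq> 0\<^sub>v k \<longrightarrow> 0 < Re (qform A v))"

definition minv :: "nat \<Rightarrow> complex mat \<Rightarrow> complex mat" where
  "minv k D = (THE E. E \<in> carrier_mat k k \<and> D * E = 1\<^sub>m k)"

text \<open>For a Hermitian (diagonalizable) matrix A, f(A) is the matrix acting as
  multiplication by f(lambda) on each lambda-eigenvector.\<close>
definition mat_fun :: "nat \<Rightarrow> (real \<Rightarrow> real) \<Rightarrow> complex mat \<Rightarrow> complex mat" where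
  "mat_fun k f A = (THE S. S \<in> carrier_mat k k \<and>
     (\<forall>v \<in> carrier_vec k. \<forall>c. A *\<^sub>v v = c \<cdot>\<^sub>v v \<longrightarrow>
        S *\<^sub>v v = complex_of_real (f (Re c)) \<cdot>\<^sub>v v))"

definition operator_monotone :: "(real \<Rightarrow> real) \<Rightarrow> bool" where
  "operator_monotone f \<longleftrightarrow> (\<forall>k A B. psd_mat k A \<longrightarrow> psd_mat k B \<longrightarrow> psd_mat k (B - A)
      \<longrightarrow> psd_mat k (mat_fun k f B - mat_fun k f A))"

text \<open>Operators M_k(C) -> M_l(C) are represented as functions on matrices;
  only their values on carrier_mat k k matter.\<close>
definition lin_map :: "nat \<Rightarrow> nat \<Rightarrow> (complex mat \<Rightarrow> complex mat) \<Rightarrow> bool" where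
  "lin_map k l T \<longleftrightarrow>
     (\<forall>X \<in> carrier_mat k k. T X \<in> carrier_mat l l) \<and>
     (\<forall>X \<in> carrier_mat k k. \<forall>Y \<in> carrier_mat k k. T (X + Y) = T X + T Y) \<and>
     (\<forall>X \<in> carrier_mat k k. \<forall>c. T (c \<cdot>\<^sub>m X) = c \<cdot>\<^sub>m T X)"

text \<open>Functional calculus of a self-adjoint (diagonalizable) operator T on M_k(C):
  the linear operator acting as f(lambda) on each lambda-eigenvector of T.\<close>
definition op_fun :: "nat \<Rightarrow> (real \<Rightarrow> real) \<Rightarrow> (complex mat \<Rightarrow> complex mat)
     \<Rightarrow> (complex mat \<Rightarrow> complex mat)" where
  "op_fun k f T = (THE S. lin_map k k S \<and>
     (\<forall>X \<in> carrier_mat k k. \<forall>c. T X = c \<cdot>\<^sub>m X \<longrightarrow>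
        S X = complex_of_real (f (Re c)) \<cdot>\<^sub>m X) \<and>
     (\<forall>X. X \<notin> carrier_mat k k \<longrightarrow> S X = 0\<^sub>m k k))"

definition Lmul :: "complex mat \<Rightarrow> complex mat \<Rightarrow> complex mat" where
  "Lmul D X = D * X"

definition Rmul :: "complex mat \<Rightarrow> complex mat \<Rightarrow> complex mat" where
  "Rmul D X = X * D"

definition Jf :: "nat \<Rightarrow> (real \<Rightarrow> real) \<Rightarrow> complex mat \<Rightarrow> complex mat
     \<Rightarrow> (complex mat \<Rightarrow> complex mat)" where
  "Jf k f D1 D2 = op_fun k f (Lmul D1 \<circ> Rmul (minv k D2)) \<circ> Rmul D2"

definition op_inv :: "nat \<Rightarrow> (complex mat \<Rightarrow> complex mat) \<Rightarrow> (complex mat \<Rightarrow> complex mat)" where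
  "op_inv k T = (\<lambda>Y. THE X. X \<in> carrier_mat k k \<and> T X = Y)"

definition hs_adjoint :: "nat \<Rightarrow> nat \<Rightarrow> (complex mat \<Rightarrow> complex mat) \<Rightarrow> (complex mat \<Rightarrow> complex mat)" where
  "hs_adjoint k l T = (\<lambda>Y. THE Z. Z \<in> carrier_mat k k \<and>
      (\<forall>X \<in> carrier_mat k k. hs_inner Z X = hs_inner Y (T X)))"

definition op_le :: "nat \<Rightarrow> (complex mat \<Rightarrow> complex mat) \<Rightarrow> (complex mat \<Rightarrow> complex mat) \<Rightarrow> bool" where
  "op_le k A B \<longleftrightarrow> (\<forall>X \<in> carrier_mat k k.
      Im (hs_inner X (B X - A X)) = 0 \<and> 0 \<le> Re (hs_inner X (B X - A X)))"

definition blk :: "nat \<Rightarrow> complex mat \<Rightarrow> nat \<Rightarrow> nat \<Rightarrow> complex mat" where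
  "blk n X i j = mat n n (\<lambda>(a,b). X $$ (i*n + a, j*n + b))"

text \<open>id_r \<otimes> beta acting on M_r(M_n) = M_{rn}, applied blockwise\<close>
definition ampl :: "nat \<Rightarrow> nat \<Rightarrow> nat \<Rightarrow> (complex mat \<Rightarrow> complex mat) \<Rightarrow> complex mat \<Rightarrow> complex mat" where
  "ampl r n m \<beta> X = mat (r*m) (r*m)
     (\<lambda>(a,b). \<beta> (blk n X (a div m) (b div m)) $$ (a mod m, b mod m))"

definition completely_positive :: "nat \<Rightarrow> nat \<Rightarrow> (complex mat \<Rightarrow> complex mat) \<Rightarrow> bool" where
  "completely_positive n m \<beta> \<longleftrightarrow> lin_map n m \<beta> \<and>
     (\<forall>r X. psd_mat (r*n) X \<longrightarrow> psd_mat (r*m) (ampl r n m \<beta> X))"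

definition trace_preserving :: "nat \<Rightarrow> (complex mat \<Rightarrow> complex mat) \<Rightarrow> bool" where
  "trace_preserving n \<beta> \<longleftrightarrow> (\<forall>X \<in> carrier_mat n n. mtrace (\<beta> X) = mtrace X)"

end

theory Submission
  imports Defs "Jordan_Normal_Form.Spectral_Radius" "HOL-Analysis.L2_Norm"
begin

text \<open>
  Put \<open>W = \<beta>\<^sup>* Y\<close>. Positivity of \<open>id\<^sub>2 \<otimes> \<beta>\<close> and trace preservation give the two Schwarz inequalities
  \<open>Tr W\<^sup>* D\<^sub>1 W \<le> Tr Y\<^sup>* \<beta>(D\<^sub>1) Y\<close> and \<open>Tr W D\<^sub>2 W\<^sup>* \<le> Tr Y \<beta>(D\<^sub>2) Y\<^sup>*\<close>. They say that
  \<open>V : Y \<beta>(D\<^sub>2)\<^sup>1\<^sup>/\<^sup>2 \<mapsto> W D\<^sub>2\<^sup>1\<^sup>/\<^sup>2\<close> is a contraction with \<open>V\<^sup>* \<Delta> V \<le> \<Delta>'\<close> for the relative modular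
  operators \<open>\<Delta>\<close>, \<open>\<Delta>'\<close> of the two pairs. Dilating \<open>V\<close> to a unitary turns operator monotonicity of
  \<open>f\<close> (in a larger dimension) into Hansen's inequality \<open>V\<^sup>* f(\<Delta>) V \<le> f(\<Delta>')\<close>, that is
  \<open>\<beta> J \<beta>\<^sup>* \<le> J'\<close>; Cauchy--Schwarz for the form of \<open>J\<close> converts this into the bound for the
  inverses. Working in the eigenbases of \<open>D\<^sub>1, D\<^sub>2\<close> and \<open>\<beta>(D\<^sub>1), \<beta>(D\<^sub>2)\<close> makes \<open>\<Delta>\<close> and \<open>\<Delta>'\<close> diagonal,
  so every inequality is one between weighted sums of squares.
\<close>

section \<open>Spectral theorem for Hermitian matrices\<close>

text \<open>The Schwarz inequalities concern \<open>\<beta>\<^sup>*\<close>, which is unital, so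
  what they bound naturally is \<open>\<beta> J \<beta>\<^sup>*\<close>; the inverses come last. For
  \<open>W = \<beta>\<^sup>* J'\<^sup>-\<^sup>1 \<beta> X\<close> the number
  \<open>Q = <X, W>\<close> satisfies \<open>Q\<^sup>2 \<le> <X, J\<^sup>-\<^sup>1 X> <W, J W> \<le>
  <X, J\<^sup>-\<^sup>1 X> Q\<close>, and cancelling \<open>Q\<close> finishes. Operator
  monotonicity compares matrices of one size, whereas \<open>V\<close> maps dimension
  \<open>m\<^sup>2\<close> to dimension \<open>n\<^sup>2\<close>. Hence two extensions:
  \<open>V\<close> becomes an isometry into dimension \<open>n\<^sup>2 + m\<^sup>2\<close>, which
  becomes a unitary in dimension \<open>n\<^sup>2 + 2 m\<^sup>2\<close>. The definition of
  \<open>operator_monotone\<close> covers all sizes, so both are available. The eigenbases of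
  \<open>D\<^sub>1\<close> and \<open>D\<^sub>2\<close> are unrelated, but left and right
  multiplications commute: one basis change on the rows and another on the columns diagonalize both.
  The index sets met on the way are products and disjoint sums, so the middle of the proof works
  with complex functions on finite sets and returns to matrices only to invoke monotonicity or the
  spectral theorem.\<close>

lemma cadj_carrier [simp, intro]: "A \<in> carrier_mat n m \<Longrightarrow> cadj A \<in> carrier_mat m n"
  by (simp add: cadj_def)

lemma cadj_dim [simp]: "dim_row (cadj A) = dim_col A" "dim_col (cadj A) = dim_row A"
  by (simp_all add: cadj_def)

lemma cadj_index [simp]: "i < dim_col A \<Longrightarrow> j < dim_row A \<Longrightarrow> cadj A $$ (i, j) = cnj (A $$ (j, i))"
  by (simp add: cadj_def)

lemma cadj_cadj [simp]: "cadj (cadj A) = A"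
  by (rule eq_matI) auto

lemma mult_mat_index:
  "A \<in> carrier_mat n k \<Longrightarrow> B \<in> carrier_mat k m \<Longrightarrow> i < n \<Longrightarrow> j < m \<Longrightarrow>
    (A * B) $$ (i, j) = (\<Sum>l<k. A $$ (i, l) * B $$ (l, j))"
  by (auto simp: scalar_prod_def atLeast0LessThan)

lemma mult_mat_vec_index:
  "A \<in> carrier_mat n k \<Longrightarrow> v \<in> carrier_vec k \<Longrightarrow> i < n \<Longrightarrow>
    (A *\<^sub>v v) $ i = (\<Sum>l<k. A $$ (i, l) * v $ l)"
  by (auto simp: scalar_prod_def atLeast0LessThan)

lemma cadj_mult:
  assumes "dim_col A = dim_row B"
  shows "cadj (A * B) = cadj B * cadj A"
  by (rule eq_matI) (use assms in \<open>auto simp: scalar_prod_def mult.commute\<close>)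

lemma dim_mat_diag [simp]: "dim_row (mat_diag n f) = n" "dim_col (mat_diag n f) = n"
  by (simp_all add: mat_diag_def)

lemma mult_mat_assoc:
  fixes A :: "'a::semiring_0 mat"
  shows "dim_col A = dim_row B \<Longrightarrow> dim_col B = dim_row C \<Longrightarrow> A * B * C = A * (B * C)"
  by (rule assoc_mult_mat) auto

lemma mult_mat_vec_assoc:
  fixes A :: "'a::semiring_0 mat"
  shows "dim_col A = dim_row B \<Longrightarrow> dim_col B = dim_vec v \<Longrightarrow> A * B *\<^sub>v v = A *\<^sub>v (B *\<^sub>v v)"
  by (rule assoc_mult_mat_vec) auto

lemma cadj_one [simp]: "cadj (1\<^sub>m n) = 1\<^sub>m n"
  by (rule eq_matI) auto

lemma cadj_minus:
  "A \<in> carrier_mat n m \<Longrightarrow> B \<in> carrier_mat n m \<Longrightarrow> cadj (A - B) = cadj A - cadj B"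
  by (rule eq_matI) auto

abbreviation rdiag :: "nat \<Rightarrow> (nat \<Rightarrow> real) \<Rightarrow> complex mat" where
  "rdiag n d \<equiv> mat_diag n (\<lambda>i. complex_of_real (d i))"

lemma cadj_rdiag [simp]: "cadj (rdiag n d) = rdiag n d"
  by (rule eq_matI) (auto simp: mat_diag_def)

definition unitary_mat :: "nat \<Rightarrow> complex mat \<Rightarrow> bool" where
  "unitary_mat n U \<longleftrightarrow> U \<in> carrier_mat n n \<and> cadj U * U = 1\<^sub>m n"

lemma unitary_matD:
  assumes "unitary_mat n U"
  shows "U \<in> carrier_mat n n" "cadj U \<in> carrier_mat n n" "cadj U * U = 1\<^sub>m n" "U * cadj U = 1\<^sub>m n"
  using assms mat_mult_left_right_inverse[of "cadj U" n U] by (auto simp: unitary_mat_def)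

lemma unitary_mat_cadj: "unitary_mat n U \<Longrightarrow> unitary_mat n (cadj U)"
  by (metis unitary_mat_def cadj_cadj unitary_matD(2,4))

lemma unitary_mat_mult:
  assumes "unitary_mat n U" "unitary_mat n V"
  shows "unitary_mat n (U * V)"
proof -
  note U = unitary_matD[OF assms(1)] and V = unitary_matD[OF assms(2)]
  have "cadj (U * V) * (U * V) = cadj V * (cadj U * U * V)"
    using U(1,2) V(1,2) by (simp add: cadj_mult mult_mat_assoc)
  then show ?thesis using U V by (simp add: unitary_mat_def)
qed

lemma unitary_mat_one: "unitary_mat n (1\<^sub>m n)"
  by (simp add: unitary_mat_def)

text \<open>Gram-Schmidt applied to a basis that begins with \<open>v\<close> keeps \<open>v\<close>
  as its first vector. Its output is orthogonal but not normalized, so the columns are divided by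
  their lengths \<open>r j\<close>; this is where the scalar \<open>c\<close> comes from.\<close>

lemma unitary_mat_first_col:
  assumes v: "v \<in> carrier_vec n" "v \<noteq> 0\<^sub>v n"
  shows "\<exists>U c. unitary_mat n U \<and> col U 0 = c \<cdot>\<^sub>v v"
proof -
  interpret cof_vec_space n "TYPE(complex)" .
  have n: "n \<noteq> 0" using v by auto
  define b where "b = basis_completion v"
  define ws where "ws = gram_schmidt n b"
  define W where "W = mat_of_cols n ws"
  from basis_completion[OF v, folded b_def]
  have b: "set b \<subseteq> carrier_vec n" "distinct b" "\<not> lin_dep (set b)" "hd b = v" "length b = n"
    by auto
  from gram_schmidt_result[OF b(1-3) refl, folded ws_def]
  have ws: "set ws \<subseteq> carrier_vec n" "corthogonal ws" "length ws = n" 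
    using b(5) by auto
  obtain vs where bv: "b = v # vs" using b(4,5) n by (cases b) auto
  have hdws: "hd ws = v" using gram_schmidt_hd[OF v(1), of vs, folded bv] unfolding ws_def .
  have W: "W \<in> carrier_mat n n" using ws mat_of_cols_carrier(1)[of n ws] by (simp add: W_def)
  have col: "col W j = ws ! j" if "j < n" for j
    using that ws col_mat_of_cols[of j ws n] by (auto simp: W_def subset_iff)
  have orth: "(\<Sum>k<n. W $$ (k, i) * cnj (W $$ (k, j))) = 0 \<longleftrightarrow> i \<noteq> j" if "i < n" "j < n" for i j
  proof -
    have "col W i \<bullet>c col W j = (\<Sum>k<n. W $$ (k, i) * cnj (W $$ (k, j)))"
      using that W by (auto simp: scalar_prod_def atLeast0LessThan)
    then show ?thesis using corthogonalD[OF ws(2), of i j] ws(3) that col by auto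
  qed
  define r where "r j = sqrt (\<Sum>k<n. (cmod (W $$ (k, j)))\<^sup>2)" for j
  have rr: "(\<Sum>k<n. W $$ (k, j) * cnj (W $$ (k, j))) = complex_of_real (r j * r j)" for j
    by (simp add: r_def sum_nonneg complex_norm_square flip: of_real_power)
  have r0: "r j \<noteq> 0" if "j < n" for j using rr[of j] orth[OF that that] by auto
  define U where "U = mat n n (\<lambda>(i, j). W $$ (i, j) / complex_of_real (r j))"
  have U: "U \<in> carrier_mat n n" by (simp add: U_def)
  have "(cadj U * U) $$ (i, j) = 1\<^sub>m n $$ (i, j)" if ij: "i < n" "j < n" for i j
  proof -
    have "(cadj U * U) $$ (i, j) = (\<Sum>k<n. cnj (U $$ (k, i)) * U $$ (k, j))"
      using mult_mat_index[OF cadj_carrier[OF U] U ij] U ij by simp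
    also have "\<dots> = (\<Sum>k<n. W $$ (k, j) * cnj (W $$ (k, i))) / (complex_of_real (r i * r j))"
      using ij by (simp add: U_def sum_divide_distrib mult.commute)
    also have "\<dots> = (if i = j then 1 else 0)"
      using orth[OF ij(2) ij(1)] rr[of j] r0[OF ij(2)] by auto
    finally show ?thesis using ij by simp
  qed
  then have "unitary_mat n U" using U by (auto simp: unitary_mat_def intro!: eq_matI)
  moreover have "col U 0 = complex_of_real (1 / r 0) \<cdot>\<^sub>v v"
  proof -
    have "col W 0 = v" using col[of 0] hdws ws(3) n hd_conv_nth[of ws] by fastforce
    then have "W $$ (i, 0) = v $ i" if "i < n" for i
      using that W n by (metis carrier_matD index_col neq0_conv)
    then show ?thesis using v n by (auto simp: U_def)
  qed
  ultimately show ?thesis by blast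
qed

lemma exists_eigenvector:
  fixes A :: "complex mat"
  assumes A: "A \<in> carrier_mat n n" and n: "n \<noteq> 0"
  shows "\<exists>v e. v \<in> carrier_vec n \<and> v \<noteq> 0\<^sub>v n \<and> A *\<^sub>v v = e \<cdot>\<^sub>v v"
  using spectrum_non_empty[OF A] n A unfolding spectrum_def eigenvalue_def eigenvector_def by auto

text \<open>Deflation. With an eigenvector as first column of a unitary \<open>U\<close>, the first
  column of \<open>cadj U * A * U\<close> is a multiple of the first unit vector, and by Hermitian
  symmetry so is the first row. The remaining block \<open>C\<close> is Hermitian of size
  \<open>n\<close>; its diagonalizing unitary \<open>Q\<close> is bordered by a 1 to give
  \<open>R\<close>.\<close>

theorem hermitian_spectral:
  assumes "A \<in> carrier_mat n n" "hermitian A"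
  shows "\<exists>U d. unitary_mat n U \<and> A * U = U * rdiag n d"
  using assms
proof (induction n arbitrary: A)
  case 0
  then show ?case by (intro exI[of _ "1\<^sub>m 0"] exI) (auto simp: unitary_mat_def mat_diag_def intro!: eq_matI)
next
  case (Suc n A)
  from exists_eigenvector[OF Suc.prems(1)] obtain v e
    where v: "v \<in> carrier_vec (Suc n)" "v \<noteq> 0\<^sub>v (Suc n)" "A *\<^sub>v v = e \<cdot>\<^sub>v v" by auto
  from unitary_mat_first_col[OF v(1,2)] obtain U c
    where U: "unitary_mat (Suc n) U" and col: "col U 0 = c \<cdot>\<^sub>v v" by blast
  note Ud = unitary_matD[OF U]
  note A = Suc.prems(1)
  have herm: "cadj A = A" using Suc.prems(2) by (simp add: hermitian_def)
  define B where "B = cadj U * (A * U)"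
  have B: "B \<in> carrier_mat (Suc n) (Suc n)" unfolding B_def using Ud(1) A by auto
  have AU: "A * U = U * B"
  proof -
    have "U * B = (U * cadj U) * (A * U)"
      using Ud(1,2) A by (simp add: B_def mult_mat_assoc)
    then show ?thesis using Ud A by simp
  qed
  have hermB: "cadj B = B"
    using Ud(1,2) A herm
    by (simp add: B_def cadj_mult
        mult_mat_assoc)
  have sym: "B $$ (i, j) = cnj (B $$ (j, i))" if "i < Suc n" "j < Suc n" for i j
    using arg_cong[OF hermB, of "\<lambda>M. M $$ (i, j)"] that B by simp
  have B0: "B $$ (i, 0) = (if i = 0 then e else 0)" if i: "i < Suc n" for i
  proof -
    have "col B 0 = cadj U *\<^sub>v (A *\<^sub>v col U 0)"
      unfolding B_def using Ud(1) A
      by (metis col_mult2 mult_carrier_mat cadj_carrier zero_less_Suc)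
    also have "A *\<^sub>v col U 0 = e \<cdot>\<^sub>v col U 0"
      using v A by (simp add: col mult_mat_vec[OF A v(1)] smult_smult_assoc mult.commute)
    also have "cadj U *\<^sub>v (e \<cdot>\<^sub>v col U 0) = e \<cdot>\<^sub>v (cadj U *\<^sub>v col U 0)"
      by (rule mult_mat_vec[OF Ud(2)]) (metis Ud(1) carrier_matD(1) col_dim)
    also have "cadj U *\<^sub>v col U 0 = col (cadj U * U) 0" using Ud(1,2) by auto
    also have "\<dots> = unit_vec (Suc n) 0" using Ud(3) by simp
    finally have "col B 0 $ i = (e \<cdot>\<^sub>v unit_vec (Suc n) 0) $ i" by simp
    then show ?thesis using B i by (auto simp: unit_vec_def)
  qed
  have B0': "B $$ (0, i) = (if i = 0 then e else 0)" if "i < Suc n" for i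
    using sym[of 0 i] B0[OF that] sym[of 0 0] B0[of 0] that by auto
  \<comment> \<open>A diagonal entry of a Hermitian matrix equals its own conjugate, so the
    eigenvalue is real.\<close>
  have re: "complex_of_real (Re e) = e"
    using sym[of 0 0] B0[of 0] by (simp add: complex_eq_iff)
  define C where "C = mat n n (\<lambda>(i, j). B $$ (Suc i, Suc j))"
  have C: "C \<in> carrier_mat n n" by (simp add: C_def)
  have "hermitian C" unfolding hermitian_def
    by (rule eq_matI) (auto simp: C_def simp flip: sym)
  from Suc.IH[OF C this] obtain Q d where Q: "unitary_mat n Q" and CQ: "C * Q = Q * rdiag n d"
    by blast
  note Qd = unitary_matD[OF Q]
  define R where "R = mat (Suc n) (Suc n) (\<lambda>(i, j). if i = 0 \<or> j = 0 then (if i = j then 1 else 0)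
      else Q $$ (i - 1, j - 1))"
  define d' where "d' i = (case i of 0 \<Rightarrow> Re e | Suc i \<Rightarrow> d i)" for i
  have R: "R \<in> carrier_mat (Suc n) (Suc n)" by (simp add: R_def)
  have Rent: "R $$ (0, 0) = 1" "i < n \<Longrightarrow> R $$ (0, Suc i) = 0" "i < n \<Longrightarrow> R $$ (Suc i, 0) = 0"
    "i < n \<Longrightarrow> j < n \<Longrightarrow> R $$ (Suc i, Suc j) = Q $$ (i, j)" for i j
    by (simp_all add: R_def)
  have uR: "unitary_mat (Suc n) R"
  proof -
    have "(cadj R * R) $$ (i, j) = 1\<^sub>m (Suc n) $$ (i, j)" if ij: "i < Suc n" "j < Suc n" for i j
    proof -
      have "(cadj R * R) $$ (i, j) = (\<Sum>k<Suc n. cnj (R $$ (k, i)) * R $$ (k, j))"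
        using mult_mat_index[OF cadj_carrier[OF R] R ij] R ij by simp
      also have "\<dots> = cnj (R $$ (0, i)) * R $$ (0, j)
            + (\<Sum>k<n. cnj (R $$ (Suc k, i)) * R $$ (Suc k, j))"
        by (simp only: sum.lessThan_Suc_shift)
      also have "\<dots> = (if i = j then 1 else 0)"
      proof (cases i)
        case 0
        then show ?thesis using ij by (cases j) (auto simp: Rent)
      next
        case (Suc i')
        show ?thesis
        proof (cases j)
          case 0
          then show ?thesis using Suc ij by (auto simp: Rent)
        next
          case (Suc j')
          have ij': "i' < n" "j' < n" using ij \<open>i = Suc i'\<close> Suc by auto
          have "(\<Sum>k<n. cnj (Q $$ (k, i')) * Q $$ (k, j')) = (if i' = j' then 1 else 0)"
            using mult_mat_index[OF cadj_carrier[OF Qd(1)] Qd(1) ij'] Qd ij' by simp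
          then show ?thesis using \<open>i = Suc i'\<close> Suc ij' by (simp add: Rent)
        qed
      qed
      finally show ?thesis using ij by simp
    qed
    then show ?thesis using R by (auto simp: unitary_mat_def intro!: eq_matI)
  qed
  have BR: "B * R = R * rdiag (Suc n) d'"
  proof (rule eq_matI)
    fix i j assume "i < dim_row (R * rdiag (Suc n) d')" "j < dim_col (R * rdiag (Suc n) d')"
    then have ij: "i < Suc n" "j < Suc n" using R by (auto simp: mat_diag_def)
    have "(B * R) $$ (i, j) = (\<Sum>k<Suc n. B $$ (i, k) * R $$ (k, j))"
      using mult_mat_index[OF B R ij] .
    also have "\<dots> = B $$ (i, 0) * R $$ (0, j) + (\<Sum>k<n. B $$ (i, Suc k) * R $$ (Suc k, j))"
      by (simp only: sum.lessThan_Suc_shift)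
    also have "\<dots> = R $$ (i, j) * complex_of_real (d' j)"
    proof (cases j)
      case 0
      then show ?thesis using ij by (cases i) (auto simp: Rent B0 d'_def re)
    next
      case (Suc j')
      show ?thesis
      proof (cases i)
        case 0
        then show ?thesis using Suc ij by (auto simp: Rent B0')
      next
        case (Suc i')
        have ij': "i' < n" "j' < n" using ij \<open>j = Suc j'\<close> Suc by auto
        have "(\<Sum>k<n. B $$ (Suc i', Suc k) * Q $$ (k, j')) = Q $$ (i', j') * complex_of_real (d j')"
          using arg_cong[OF CQ, of "\<lambda>M. M $$ (i', j')"] mult_mat_index[OF C Qd(1) ij'] ij'
          by (simp add: mat_diag_mult_right[OF Qd(1)] C_def)
        then show ?thesis using \<open>j = Suc j'\<close> Suc ij' by (simp add: Rent d'_def)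
      qed
    qed
    finally show "(B * R) $$ (i, j) = (R * rdiag (Suc n) d') $$ (i, j)"
      using ij by (simp add: mat_diag_mult_right[OF R])
  qed (use B R in \<open>auto simp: mat_diag_def\<close>)
  have "A * (U * R) = U * (B * R)"
    unfolding assoc_mult_mat[OF A Ud(1) R, symmetric] AU by (rule assoc_mult_mat[OF Ud(1) B R])
  also have "\<dots> = U * R * rdiag (Suc n) d'"
    unfolding BR using Ud(1) R by (simp add: mult_mat_assoc)
  finally show ?case using unitary_mat_mult[OF U uR] by blast
qed

section \<open>Operator monotonicity for quadratic forms\<close>

text \<open>Shows that the description in \<open>mat_fun\<close> has exactly one solution. In the
  coordinates \<open>cadj U *\<^sub>v v\<close>, an eigenvector for \<open>c\<close> can only be
  supported where \<open>d i = Re c\<close>, so the candidate acts on it as demanded. The columns of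
  \<open>U\<close> are eigenvectors that span the space, so any other solution agrees with
  it.\<close>

lemma mat_fun_unitary:
  assumes U: "unitary_mat n U"
  shows "mat_fun n f (U * rdiag n d * cadj U) = U * rdiag n (\<lambda>i. f (d i)) * cadj U"
proof -
  note Ud = unitary_matD[OF U]
  let ?A = "U * rdiag n d * cadj U" and ?S = "U * rdiag n (\<lambda>i. f (d i)) * cadj U"
  have S: "?S \<in> carrier_mat n n" and A: "?A \<in> carrier_mat n n" using Ud by auto
  have key: "U * rdiag n g * cadj U *\<^sub>v v = U *\<^sub>v (rdiag n g *\<^sub>v (cadj U *\<^sub>v v))"
    if "v \<in> carrier_vec n" for v g
    using Ud(1) that by (simp add: mult_mat_vec_assoc)
  have dvec: "(rdiag n g *\<^sub>v w) $ i = complex_of_real (g i) * w $ i"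
    if "w \<in> carrier_vec n" "i < n" for g w i
    using that mult_mat_vec_index[of "rdiag n g" n n w i]
    by (simp add: mat_diag_def if_distrib if_distribR sum.delta cong: if_cong)
  show ?thesis unfolding mat_fun_def
  proof (rule the_equality, intro conjI ballI allI impI)
    fix v c assume v: "v \<in> carrier_vec n" and Av: "?A *\<^sub>v v = c \<cdot>\<^sub>v v"
    define w where "w = cadj U *\<^sub>v v"
    have w: "w \<in> carrier_vec n" unfolding w_def by (rule mult_mat_vec_carrier[OF Ud(2) v])
    have Uw: "U *\<^sub>v w = v" unfolding w_def using Ud v
      by (simp flip: assoc_mult_mat_vec[of _ n n _ n])
    have "rdiag n d *\<^sub>v w = cadj U *\<^sub>v (U *\<^sub>v (rdiag n d *\<^sub>v w))"
      using Ud w by (simp add: mult_mat_vec_carrier[of _ n n] flip: assoc_mult_mat_vec[of "cadj U" n n U n])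
    also have "\<dots> = cadj U *\<^sub>v (c \<cdot>\<^sub>v v)" using key[OF v, of d] Av by (simp add: w_def)
    also have "\<dots> = c \<cdot>\<^sub>v w" unfolding w_def by (rule mult_mat_vec[OF Ud(2) v])
    finally have dw: "rdiag n d *\<^sub>v w = c \<cdot>\<^sub>v w" .
    have "rdiag n (\<lambda>i. f (d i)) *\<^sub>v w = complex_of_real (f (Re c)) \<cdot>\<^sub>v w"
    proof (rule eq_vecI)
      fix i assume "i < dim_vec (complex_of_real (f (Re c)) \<cdot>\<^sub>v w)"
      then have i: "i < n" using w by simp
      have "complex_of_real (d i) * w $ i = c * w $ i"
        using arg_cong[OF dw, of "\<lambda>v. v $ i"] dvec[OF w i] i w by simp
      then have "w $ i = 0 \<or> d i = Re c" by auto
      then show "(rdiag n (\<lambda>i. f (d i)) *\<^sub>v w) $ i = (complex_of_real (f (Re c)) \<cdot>\<^sub>v w) $ i"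
        using dvec[OF w i] i w by auto
    qed (use w in \<open>simp add: mat_diag_def\<close>)
    then show "?S *\<^sub>v v = complex_of_real (f (Re c)) \<cdot>\<^sub>v v"
      using key[OF v] mult_mat_vec[OF Ud(1) w] Uw by (simp add: w_def)
  next
    fix S' assume S': "S' \<in> carrier_mat n n \<and> (\<forall>v\<in>carrier_vec n. \<forall>c. ?A *\<^sub>v v = c \<cdot>\<^sub>v v \<longrightarrow>
        S' *\<^sub>v v = complex_of_real (f (Re c)) \<cdot>\<^sub>v v)"
    have colD: "col (U * rdiag n g) j = complex_of_real (g j) \<cdot>\<^sub>v col U j" if "j < n" for g j
      using that Ud by (auto simp: mat_diag_mult_right[of U n n] mult.commute)
    have "col (S' * U) j = col (U * rdiag n (\<lambda>i. f (d i))) j" if j: "j < n" for j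
    proof -
      have "?A * U = U * rdiag n d"
        using Ud by (simp add: mult_mat_assoc)
      then have "?A *\<^sub>v col U j = complex_of_real (d j) \<cdot>\<^sub>v col U j"
        using col_mult2[OF A Ud(1) j] colD[OF j, of d] by simp
      then have "S' *\<^sub>v col U j = complex_of_real (f (d j)) \<cdot>\<^sub>v col U j"
        using S' Ud(1) j by auto
      then show ?thesis using col_mult2[of S' n n U n j] S' Ud(1) j colD[OF j, of "\<lambda>i. f (d i)"] by simp
    qed
    then have "S' * U = U * rdiag n (\<lambda>i. f (d i))"
      by (intro mat_col_eqI) (use S' Ud in \<open>auto simp: mat_diag_def\<close>)
    then have "S' * U * cadj U = ?S" by simp
    moreover have "S' * U * cadj U = S'" using S' Ud by (metis assoc_mult_mat right_mult_one_mat)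
    ultimately show "S' = ?S" by simp
  qed (rule S)
qed

lemma qform_cadj_mult:
  assumes "M \<in> carrier_mat k n" "N \<in> carrier_mat k n" "v \<in> carrier_vec n"
  shows "qform (cadj M * N) v = (\<Sum>i<k. cnj ((M *\<^sub>v v) $ i) * (N *\<^sub>v v) $ i)"
proof -
  have "qform (cadj M * N) v = (\<Sum>i<n. cnj (v $ i) * (cadj M *\<^sub>v (N *\<^sub>v v)) $ i)"
    using assms by (simp add: qform_def assoc_mult_mat_vec[of _ n k])
  also have "\<dots> = (\<Sum>i<n. cnj (v $ i) * (\<Sum>l<k. cnj (M $$ (l, i)) * (N *\<^sub>v v) $ l))"
    using assms by (intro sum.cong refl arg_cong2[of _ _ _ _ "(*)"])
      (simp add: mult_mat_vec_index[of "cadj M" n k] mult_mat_vec_carrier[of _ k n] del: index_mult_mat_vec)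
  also have "\<dots> = (\<Sum>l<k. (\<Sum>i<n. cnj (M $$ (l, i)) * cnj (v $ i)) * (N *\<^sub>v v) $ l)"
    unfolding sum_distrib_left sum_distrib_right by (subst sum.swap) (simp add: mult_ac)
  also have "\<dots> = (\<Sum>l<k. cnj ((M *\<^sub>v v) $ l) * (N *\<^sub>v v) $ l)"
    using assms
    by (intro sum.cong refl) (simp add: mult_mat_vec_index[of M k n] del: index_mult_mat_vec)
  finally show ?thesis .
qed

lemma qform_rdiag_conj:
  assumes M: "M \<in> carrier_mat k n" and v: "v \<in> carrier_vec n"
  shows "qform (cadj M * rdiag k d * M) v = complex_of_real (\<Sum>i<k. d i * (cmod ((M *\<^sub>v v) $ i))\<^sup>2)"
proof -
  have N: "rdiag k d * M \<in> carrier_mat k n" using M by (rule mult_carrier_mat[OF mat_diag_dim])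
  have ent: "((rdiag k d * M) *\<^sub>v v) $ i = complex_of_real (d i) * (M *\<^sub>v v) $ i" if i: "i < k" for i
    unfolding mult_mat_vec_index[OF N v i] mult_mat_vec_index[OF M v i]
    using i M by (simp add: mat_diag_mult_left[OF M] sum_distrib_left mult.assoc)
  have "qform (cadj M * rdiag k d * M) v = qform (cadj M * (rdiag k d * M)) v"
    using M by (simp add: mult_mat_assoc)
  also have "\<dots> = (\<Sum>i<k. cnj ((M *\<^sub>v v) $ i) * ((rdiag k d * M) *\<^sub>v v) $ i)"
    by (rule qform_cadj_mult[OF M N v])
  also have "\<dots> = (\<Sum>i<k. complex_of_real (d i * (cmod ((M *\<^sub>v v) $ i))\<^sup>2))"
    by (intro sum.cong refl)
      (simp add: ent complex_norm_square mult_ac del: of_real_power index_mult_mat_vec)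
  finally show ?thesis by simp
qed

lemma qform_minus:
  assumes "A \<in> carrier_mat n n" "B \<in> carrier_mat n n" "v \<in> carrier_vec n"
  shows "qform (A - B) v = qform A v - qform B v"
  using assms
  by (simp add: qform_def minus_mult_distrib_mat_vec[of _ n n] right_diff_distrib sum_subtractf)

text \<open>Operator monotonicity for \<open>cadj u * diag d * u\<close> against
  \<open>diag e\<close>, expressed by quadratic forms. The index set is an arbitrary finite set,
  numbered by \<open>h\<close> only inside this proof, so that later uses may take disjoint sums of
  index sets.\<close>

lemma operator_monotone_sum:
  fixes S :: "'a set" and u :: "'a \<Rightarrow> 'a \<Rightarrow> complex"
  assumes f: "operator_monotone f" and S: "finite S"
    and u: "\<And>i j. i \<in> S \<Longrightarrow> j \<in> S \<Longrightarrow> (\<Sum>k\<in>S. cnj (u k i) * u k j) = (if i = j then 1 else 0)"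
    and d: "\<And>i. i \<in> S \<Longrightarrow> 0 \<le> d i" and e: "\<And>i. i \<in> S \<Longrightarrow> 0 \<le> e i"
    and le: "\<And>z. (\<Sum>i\<in>S. d i * (cmod (\<Sum>j\<in>S. u i j * z j))\<^sup>2) \<le> (\<Sum>i\<in>S. e i * (cmod (z i))\<^sup>2)"
  shows "(\<Sum>i\<in>S. f (d i) * (cmod (\<Sum>j\<in>S. u i j * z j))\<^sup>2) \<le> (\<Sum>i\<in>S. f (e i) * (cmod (z i))\<^sup>2)"
proof -
  define K where "K = card S"
  obtain h where h: "bij_betw h {..<K} S"
    using ex_bij_betw_nat_finite[OF S] by (auto simp: K_def atLeast0LessThan)
  have hS: "h i \<in> S" if "i < K" for i using h that by (auto simp: bij_betw_def)
  have hinj: "h i = h j \<longleftrightarrow> i = j" if "i < K" "j < K" for i j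
    using h that by (auto simp: bij_betw_def inj_on_def)
  have reidx: "(\<Sum>i<K. g (h i)) = (\<Sum>i\<in>S. g i)" for g :: "'a \<Rightarrow> 'b::comm_monoid_add"
    by (rule sum.reindex_bij_betw[OF h])
  define M where "M = mat K K (\<lambda>(i, j). u (h i) (h j))"
  have M: "M \<in> carrier_mat K K" by (simp add: M_def)
  have "(cadj M * M) $$ (i, j) = 1\<^sub>m K $$ (i, j)" if ij: "i < K" "j < K" for i j
  proof -
    have "(cadj M * M) $$ (i, j) = (\<Sum>k<K. cnj (u (h k) (h i)) * u (h k) (h j))"
      using mult_mat_index[OF cadj_carrier[OF M] M ij] ij M by (simp add: M_def)
    also have "\<dots> = (\<Sum>k\<in>S. cnj (u k (h i)) * u k (h j))" by (rule reidx)
    also have "\<dots> = (if i = j then 1 else 0)" using u hS hinj ij by simp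
    finally show ?thesis using ij by simp
  qed
  then have uM: "unitary_mat K M" using M by (auto simp: unitary_mat_def intro!: eq_matI)
  define A where "A g = cadj M * rdiag K (\<lambda>i. g (h i)) * M" for g :: "'a \<Rightarrow> real"
  \<comment> \<open>The conjugation by the identity gives \<open>B\<close> the same shape as
    \<open>A\<close>, so that the same lemmas evaluate its quadratic form and its functional
    calculus.\<close>
  define B where "B g = cadj (1\<^sub>m K) * rdiag K (\<lambda>i. g (h i)) * 1\<^sub>m K" for g :: "'a \<Rightarrow> real"
  have A: "A g \<in> carrier_mat K K" and B: "B g \<in> carrier_mat K K" for g
    using M by (auto simp: A_def B_def mat_diag_def)
  have herm: "cadj (A g) = A g" "cadj (B g) = B g" for g
    using M by (simp_all add: A_def B_def cadj_mult mult_mat_assoc)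
  define zv where "zv v x = v $ (inv_into {..<K} h x)" for v :: "complex vec" and x
  have zv: "zv v (h i) = v $ i" if "i < K" for v i
    using h that by (simp add: zv_def bij_betw_def)
  have Mv: "(M *\<^sub>v v) $ i = (\<Sum>j\<in>S. u (h i) j * zv v j)" if "v \<in> carrier_vec K" "i < K" for v i
  proof -
    have "(M *\<^sub>v v) $ i = (\<Sum>l<K. u (h i) (h l) * zv v (h l))"
      unfolding mult_mat_vec_index[OF M that] using that by (simp add: M_def zv)
    then show ?thesis using reidx[of "\<lambda>j. u (h i) j * zv v j"] by simp
  qed
  have qA: "qform (A g) v = complex_of_real (\<Sum>i\<in>S. g i * (cmod (\<Sum>j\<in>S. u i j * zv v j))\<^sup>2)"
    if v: "v \<in> carrier_vec K" for g v
    unfolding A_def qform_rdiag_conj[OF M v]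
    using reidx[of "\<lambda>i. g i * (cmod (\<Sum>j\<in>S. u i j * zv v j))\<^sup>2"] Mv[OF v] by simp
  have qB: "qform (B g) v = complex_of_real (\<Sum>i\<in>S. g i * (cmod (zv v i))\<^sup>2)"
    if v: "v \<in> carrier_vec K" for g v
    unfolding B_def qform_rdiag_conj[OF one_carrier_mat v]
    using reidx[of "\<lambda>i. g i * (cmod (zv v i))\<^sup>2"] v by (simp add: zv)
  have psdA: "psd_mat K (A d)"
    using A herm d by (auto simp: psd_mat_def hermitian_def qA intro!: sum_nonneg)
  have psdB: "psd_mat K (B e)"
    using B herm e by (auto simp: psd_mat_def hermitian_def qB intro!: sum_nonneg)
  have psdBA: "psd_mat K (B e - A d)"
    using A B herm le
    by (auto simp: psd_mat_def hermitian_def cadj_minus[of _ K K] qform_minus[of _ K] qA qB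
        intro!: minus_carrier_mat)
  have fA: "mat_fun K f (A d) = A (\<lambda>i. f (d i))"
    using mat_fun_unitary[OF unitary_mat_cadj[OF uM], of f "\<lambda>i. d (h i)"] by (simp add: A_def)
  have fB: "mat_fun K f (B e) = B (\<lambda>i. f (e i))"
    using mat_fun_unitary[OF unitary_mat_one, of K f "\<lambda>i. e (h i)"] by (simp add: B_def)
  have "psd_mat K (B (\<lambda>i. f (e i)) - A (\<lambda>i. f (d i)))"
    using f psdA psdB psdBA unfolding operator_monotone_def fA[symmetric] fB[symmetric] by blast
  moreover define v where "v = vec K (\<lambda>i. z (h i))"
  have v: "v \<in> carrier_vec K" by (simp add: v_def)
  have zvz: "zv v x = z x" if "x \<in> S" for x
  proof -
    obtain i where "i < K" "x = h i" using h \<open>x \<in> S\<close> unfolding bij_betw_def by blast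
    then show ?thesis using zv[of i v] by (simp add: v_def)
  qed
  ultimately have "0 \<le> Re (qform (B (\<lambda>i. f (e i)) - A (\<lambda>i. f (d i))) v)"
    using v by (simp add: psd_mat_def)
  then show ?thesis
    using A B v by (simp add: qform_minus[of _ K] qA qB zvz)
qed

section \<open>Dilations and Hansen's inequality\<close>

text \<open>Expanding \<open>(t |x| - |y|)\<^sup>2 / t \<ge> 0\<close> bounds the cross term. The
  weight \<open>t\<close> will be the slack \<open>\<eta>\<close>: the first summand then costs only
  the factor \<open>1 + \<eta>\<close>, and the second absorbs the large factor.\<close>

lemma norm_add_squared_le:
  fixes x y :: complex and t :: real
  assumes "t > 0"
  shows "(cmod (x + y))\<^sup>2 \<le> (1 + t) * (cmod x)\<^sup>2 + (1 + 1 / t) * (cmod y)\<^sup>2"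
proof -
  have "(cmod (x + y))\<^sup>2 \<le> (cmod x + cmod y)\<^sup>2"
    by (intro power_mono norm_triangle_ineq) simp
  moreover have "0 \<le> (t * cmod x - cmod y)\<^sup>2 / t" using assms by simp
  moreover have "(t * cmod x - cmod y)\<^sup>2 / t = t * (cmod x)\<^sup>2 + (cmod y)\<^sup>2 / t - 2 * cmod x * cmod y"
    using assms by (simp add: field_simps power2_eq_square)
  ultimately show ?thesis by (simp add: algebra_simps power2_sum)
qed

lemma norm_sum_mult_squared_le:
  fixes g z :: "'a \<Rightarrow> complex"
  shows "(cmod (\<Sum>l\<in>K. g l * z l))\<^sup>2 \<le> (\<Sum>l\<in>K. (cmod (g l))\<^sup>2) * (\<Sum>l\<in>K. (cmod (z l))\<^sup>2)"
proof -
  have "cmod (\<Sum>l\<in>K. g l * z l) \<le> (\<Sum>l\<in>K. \<bar>cmod (g l)\<bar> * \<bar>cmod (z l)\<bar>)"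
    by (rule order_trans[OF norm_sum]) (simp add: norm_mult)
  also have "\<dots> \<le> L2_set (\<lambda>l. cmod (g l)) K * L2_set (\<lambda>l. cmod (z l)) K"
    by (rule L2_set_mult_ineq)
  finally have "(cmod (\<Sum>l\<in>K. g l * z l))\<^sup>2 \<le> (L2_set (\<lambda>l. cmod (g l)) K * L2_set (\<lambda>l. cmod (z l)) K)\<^sup>2"
    by (intro power_mono) auto
  then show ?thesis by (simp add: L2_set_def power_mult_distrib sum_nonneg)
qed

text \<open>The block matrix with rows \<open>(0, T\<^sup>*)\<close> and \<open>(T, 1 - T T\<^sup>*)\<close>: a self-adjoint unitary when \<open>T\<close> is an isometry.\<close>
definition refl_dilation ::
  "'b set \<Rightarrow> ('c \<Rightarrow> 'b \<Rightarrow> complex) \<Rightarrow> 'b + 'c \<Rightarrow> 'b + 'c \<Rightarrow> complex" where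
  "refl_dilation J T x y = (case x of
      Inl i \<Rightarrow> (case y of Inl j \<Rightarrow> 0 | Inr k \<Rightarrow> cnj (T k i))
    | Inr k \<Rightarrow> (case y of Inl j \<Rightarrow> T k j
        | Inr l \<Rightarrow> (if k = l then 1 else 0) - (\<Sum>j\<in>J. T k j * cnj (T l j))))"

text \<open>For an isometry \<open>T\<close>, the kernel \<open>G\<close> of
  \<open>T T\<^sup>*\<close> is a projection with \<open>T\<^sup>* G = T\<^sup>*\<close>
  (\<open>TG\<close>) and \<open>G G = G\<close> (\<open>GG\<close>). Each of the four block cases
  is an expansion followed by these identities.\<close>

lemma refl_dilation_unitary:
  fixes T :: "'c \<Rightarrow> 'b \<Rightarrow> complex"
  assumes J: "finite J" and K: "finite K"
    and T: "\<And>i j. i \<in> J \<Longrightarrow> j \<in> J \<Longrightarrow> (\<Sum>k\<in>K. cnj (T k i) * T k j) = (if i = j then 1 else 0)"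
    and xy: "x \<in> J <+> K" "y \<in> J <+> K"
  shows "(\<Sum>w\<in>J <+> K. cnj (refl_dilation J T w x) * refl_dilation J T w y) = (if x = y then 1 else 0)"
proof -
  define G where "G k l = (\<Sum>j\<in>J. T k j * cnj (T l j))" for k l
  have Gc: "cnj (G k l) = G l k" for k l by (simp add: G_def mult.commute)
  have TG: "(\<Sum>k\<in>K. cnj (T k i) * G k l) = cnj (T l i)" if "i \<in> J" for i l
  proof -
    have "(\<Sum>k\<in>K. cnj (T k i) * G k l) = (\<Sum>j\<in>J. (\<Sum>k\<in>K. cnj (T k i) * T k j) * cnj (T l j))"
      unfolding G_def sum_distrib_left sum_distrib_right by (subst sum.swap) (simp add: mult_ac)
    also have "\<dots> = (\<Sum>j\<in>J. if i = j then cnj (T l j) else 0)"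
      using T that by (intro sum.cong) auto
    finally show ?thesis using that J by simp
  qed
  have GG: "(\<Sum>w\<in>K. G k w * G w l) = G k l" for k l
  proof -
    have "(\<Sum>w\<in>K. G k w * G w l) = (\<Sum>j\<in>J. T k j * (\<Sum>w\<in>K. cnj (T w j) * G w l))"
      unfolding G_def[of k] sum_distrib_left sum_distrib_right
      by (subst sum.swap) (simp add: mult_ac sum_distrib_left)
    also have "\<dots> = G k l" unfolding G_def[of k l] using TG by (intro sum.cong) auto
    finally show ?thesis .
  qed
  have split: "(\<Sum>w\<in>J <+> K. h w) = (\<Sum>w\<in>J. h (Inl w)) + (\<Sum>w\<in>K. h (Inr w))"
    for h :: "'b + 'c \<Rightarrow> complex"
    using J K by (simp add: sum.Plus)
  have dl: "(\<Sum>w\<in>K. (if w = k then 1 else 0) * h w) = h k" if "k \<in> K" for k and h :: "'c \<Rightarrow> complex"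
    using K that by (simp add: if_distrib if_distribR cong: if_cong)
  note R = refl_dilation_def G_def[symmetric]
  consider (ll) i j where "x = Inl i" "y = Inl j" "i \<in> J" "j \<in> J"
    | (lr) i l where "x = Inl i" "y = Inr l" "i \<in> J" "l \<in> K"
    | (rl) k j where "x = Inr k" "y = Inl j" "k \<in> K" "j \<in> J"
    | (rr) k l where "x = Inr k" "y = Inr l" "k \<in> K" "l \<in> K"
    using xy by blast
  then show ?thesis
  proof cases
    case ll
    then show ?thesis by (simp add: split R T)
  next
    case lr
    have "(\<Sum>w\<in>K. cnj (T w i) * ((if w = l then 1 else 0) - G w l))
        = (\<Sum>w\<in>K. (if w = l then 1 else 0) * cnj (T w i)) - (\<Sum>w\<in>K. cnj (T w i) * G w l)"
      by (simp add: algebra_simps sum_subtractf)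
    then show ?thesis using lr dl[of l "\<lambda>w. cnj (T w i)"] TG by (simp add: split R)
  next
    case rl
    have "(\<Sum>w\<in>K. cnj ((if w = k then 1 else 0) - G w k) * T w j)
        = (\<Sum>w\<in>K. (if w = k then 1 else 0) * T w j) - cnj (\<Sum>w\<in>K. cnj (T w j) * G w k)"
      unfolding cnj_sum sum_subtractf[symmetric]
      by (intro sum.cong refl) (simp add: algebra_simps)
    then show ?thesis using rl dl[of k "\<lambda>w. T w j"] TG by (simp add: split R)
  next
    case rr
    have "(\<Sum>w\<in>K. cnj ((if w = k then 1 else 0) - G w k) * ((if w = l then 1 else 0) - G w l))
        = (\<Sum>w\<in>K. (if w = k then 1 else 0) * ((if w = l then 1 else 0) - G w l))
          - (\<Sum>w\<in>K. (if w = l then 1 else 0) * G k w) + (\<Sum>w\<in>K. G k w * G w l)"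
      unfolding sum_subtractf[symmetric] sum.distrib[symmetric]
      by (intro sum.cong refl) (simp add: algebra_simps Gc)
    also have "\<dots> = (if k = l then 1 else 0) - G k l"
      using rr by (simp only: dl GG) simp
    finally show ?thesis using rr by (simp add: split R Gc)
  qed
qed

text \<open>
  The slack \<open>\<eta>\<close> absorbs the off-diagonal blocks of the dilated operator, so that it lies below
  the diagonal operator \<open>e\<close>, \<open>C\<close> once the constant \<open>C\<close> is large.
\<close>
lemma operator_monotone_isometry:
  fixes T :: "'c \<Rightarrow> 'b \<Rightarrow> complex"
  assumes f: "operator_monotone f" and f0: "0 \<le> f 0"
    and J: "finite J" and K: "finite K"
    and T: "\<And>i j. i \<in> J \<Longrightarrow> j \<in> J \<Longrightarrow> (\<Sum>k\<in>K. cnj (T k i) * T k j) = (if i = j then 1 else 0)"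
    and d: "\<And>k. k \<in> K \<Longrightarrow> 0 \<le> d k" and e: "\<And>j. j \<in> J \<Longrightarrow> 0 \<le> e j"
    and \<eta>: "0 < \<eta>" "\<eta> < 1"
    and le: "\<And>z. (\<Sum>k\<in>K. d k * (cmod (\<Sum>j\<in>J. T k j * z j))\<^sup>2) \<le> (1 - \<eta>) * (\<Sum>j\<in>J. e j * (cmod (z j))\<^sup>2)"
  shows "(\<Sum>k\<in>K. f (d k) * (cmod (\<Sum>j\<in>J. T k j * z j))\<^sup>2) \<le> (\<Sum>j\<in>J. f (e j) * (cmod (z j))\<^sup>2)"
proof -
  define u where "u = refl_dilation J T"
  define G where "G k l = u (Inr k) (Inr l)" for k l
  \<comment> \<open>\<open>1 + 1 / \<eta>\<close> is the price of splitting the square of a sum with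
    weight \<open>\<eta>\<close>; the inner sum is the squared norm of row \<open>k\<close> of
    \<open>G\<close>, from Cauchy-Schwarz.\<close>
  define C where "C = (1 + 1 / \<eta>) * (\<Sum>k\<in>K. d k * (\<Sum>l\<in>K. (cmod (G k l))\<^sup>2))"
  define d' :: "'b + 'c \<Rightarrow> real" where "d' = case_sum (\<lambda>_. 0) d"
  define e' :: "'b + 'c \<Rightarrow> real" where "e' = case_sum e (\<lambda>_. C)"
  have C: "0 \<le> C" unfolding C_def using d \<eta> by (intro mult_nonneg_nonneg sum_nonneg) auto
  have split: "(\<Sum>w\<in>J <+> K. h w) = (\<Sum>w\<in>J. h (Inl w)) + (\<Sum>w\<in>K. h (Inr w))"
    for h :: "'b + 'c \<Rightarrow> 'z::comm_monoid_add"
    using J K by (simp add: sum.Plus)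
  have ul: "u (Inr k) (Inl j) = T k j" "u (Inl i) (Inl j) = 0" for i j k
    by (simp_all add: u_def refl_dilation_def)
  have main: "(\<Sum>i\<in>J <+> K. f (d' i) * (cmod (\<Sum>j\<in>J <+> K. u i j * Z j))\<^sup>2)
      \<le> (\<Sum>i\<in>J <+> K. f (e' i) * (cmod (Z i))\<^sup>2)" for Z
  proof (rule operator_monotone_sum[OF f])
    fix Z
    let ?x = "\<lambda>k. \<Sum>j\<in>J. T k j * Z (Inl j)" and ?y = "\<lambda>k. \<Sum>l\<in>K. G k l * Z (Inr l)"
    have "(\<Sum>i\<in>J <+> K. d' i * (cmod (\<Sum>j\<in>J <+> K. u i j * Z j))\<^sup>2)
        = (\<Sum>k\<in>K. d k * (cmod (?x k + ?y k))\<^sup>2)"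
      by (simp add: split d'_def ul G_def)
    also have "\<dots> \<le> (\<Sum>k\<in>K. d k * ((1 + \<eta>) * (cmod (?x k))\<^sup>2 + (1 + 1 / \<eta>) * (cmod (?y k))\<^sup>2))"
      using d \<eta> by (intro sum_mono mult_left_mono norm_add_squared_le) auto
    also have "\<dots> = (1 + \<eta>) * (\<Sum>k\<in>K. d k * (cmod (?x k))\<^sup>2) + (1 + 1 / \<eta>) * (\<Sum>k\<in>K. d k * (cmod (?y k))\<^sup>2)"
      by (simp add: sum_distrib_left sum.distrib ring_distribs mult_ac)
    also have "\<dots> \<le> (1 + \<eta>) * ((1 - \<eta>) * (\<Sum>j\<in>J. e j * (cmod (Z (Inl j)))\<^sup>2))
        + (1 + 1 / \<eta>) * (\<Sum>k\<in>K. d k * ((\<Sum>l\<in>K. (cmod (G k l))\<^sup>2) * (\<Sum>l\<in>K. (cmod (Z (Inr l)))\<^sup>2)))"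
      using d \<eta> by (intro add_mono mult_left_mono sum_mono le norm_sum_mult_squared_le) auto
    also have "(1 + 1 / \<eta>) * (\<Sum>k\<in>K. d k * ((\<Sum>l\<in>K. (cmod (G k l))\<^sup>2) * (\<Sum>l\<in>K. (cmod (Z (Inr l)))\<^sup>2)))
        = C * (\<Sum>l\<in>K. (cmod (Z (Inr l)))\<^sup>2)"
      unfolding C_def by (simp add: sum_distrib_right mult.assoc)
    also have "(1 + \<eta>) * ((1 - \<eta>) * (\<Sum>j\<in>J. e j * (cmod (Z (Inl j)))\<^sup>2))
        \<le> (\<Sum>j\<in>J. e j * (cmod (Z (Inl j)))\<^sup>2)"
    proof -
      have "(1 + \<eta>) * (1 - \<eta>) \<le> 1" using \<eta> by (simp add: algebra_simps)
      moreover have "0 \<le> (\<Sum>j\<in>J. e j * (cmod (Z (Inl j)))\<^sup>2)" using e by (intro sum_nonneg) auto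
      ultimately show ?thesis
        using mult_right_mono[of "(1 + \<eta>) * (1 - \<eta>)" 1 "\<Sum>j\<in>J. e j * (cmod (Z (Inl j)))\<^sup>2"]
        by (simp only: mult.assoc mult_1)
    qed
    also have "(\<Sum>j\<in>J. e j * (cmod (Z (Inl j)))\<^sup>2) + C * (\<Sum>l\<in>K. (cmod (Z (Inr l)))\<^sup>2)
        = (\<Sum>i\<in>J <+> K. e' i * (cmod (Z i))\<^sup>2)"
      by (simp add: split e'_def sum_distrib_left)
    finally show "(\<Sum>i\<in>J <+> K. d' i * (cmod (\<Sum>j\<in>J <+> K. u i j * Z j))\<^sup>2)
        \<le> (\<Sum>i\<in>J <+> K. e' i * (cmod (Z i))\<^sup>2)" by simp
  next
    fix x y assume "x \<in> J <+> K" "y \<in> J <+> K"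
    then show "(\<Sum>w\<in>J <+> K. cnj (u w x) * u w y) = (if x = y then 1 else 0)"
      unfolding u_def by (intro refl_dilation_unitary J K T)
  qed (use J K d e C in \<open>auto simp: d'_def e'_def\<close>)
  \<comment> \<open>The dilation sends \<open>(z, 0)\<close> to \<open>(0, T z)\<close>. The
    artificial weights, 0 on the \<open>J\<close> part of \<open>d'\<close> and \<open>C\<close> on
    the \<open>K\<close> part of \<open>e'\<close>, therefore meet only zero coordinates.\<close>
  show ?thesis using main[of "case_sum z (\<lambda>_. 0)"] by (simp add: split d'_def e'_def ul)
qed

text \<open>Diagonalizing the kernel as \<open>U * diag d * cadj U\<close> gives the Gram factor
  \<open>W = diag (sqrt d) * cadj U\<close>. It will supply a factor of the defect
  \<open>1 - V\<^sup>* V\<close> of a contraction.\<close>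

lemma positive_kernel_factorization:
  fixes G :: "'b \<Rightarrow> 'b \<Rightarrow> complex"
  assumes J: "finite J"
    and herm: "\<And>i j. i \<in> J \<Longrightarrow> j \<in> J \<Longrightarrow> G j i = cnj (G i j)"
    and pos: "\<And>z. 0 \<le> Re (\<Sum>i\<in>J. \<Sum>j\<in>J. cnj (z i) * G i j * z j)"
  shows "\<exists>W :: nat \<Rightarrow> 'b \<Rightarrow> complex. \<forall>i\<in>J. \<forall>j\<in>J. (\<Sum>k<card J. cnj (W k i) * W k j) = G i j"
proof -
  define K where "K = card J"
  obtain h where h: "bij_betw h {..<K} J"
    using ex_bij_betw_nat_finite[OF J] by (auto simp: K_def atLeast0LessThan)
  have hJ: "h i \<in> J" if "i < K" for i using h that by (auto simp: bij_betw_def)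
  define g where "g = inv_into {..<K} h"
  have gh: "g (h i) = i" if "i < K" for i using h that by (simp add: g_def bij_betw_def)
  have hg: "h (g x) = x" "g x < K" if "x \<in> J" for x
    using h that unfolding g_def bij_betw_def by (auto intro: f_inv_into_f inv_into_into[of x h "{..<K}", simplified])
  have reidx: "(\<Sum>i<K. F (h i)) = (\<Sum>i\<in>J. F i)" for F :: "'b \<Rightarrow> complex"
    by (rule sum.reindex_bij_betw[OF h])
  define A where "A = mat K K (\<lambda>(i, j). G (h i) (h j))"
  have A: "A \<in> carrier_mat K K" by (simp add: A_def)
  have "hermitian A" unfolding hermitian_def
    by (rule eq_matI) (auto simp: A_def hJ simp flip: herm)
  from hermitian_spectral[OF A this] obtain U d where U: "unitary_mat K U" and AU: "A * U = U * rdiag K d"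
    by blast
  note Ud = unitary_matD[OF U]
  have Aeq: "A = U * rdiag K d * cadj U"
    using A Ud unfolding AU[symmetric] by (simp add: mult_mat_assoc)
  have ent: "A $$ (i, j) = (\<Sum>k<K. U $$ (i, k) * complex_of_real (d k) * cnj (U $$ (j, k)))"
    if "i < K" "j < K" for i j
  proof -
    have "U * rdiag K d \<in> carrier_mat K K" using Ud(1) by auto
    from mult_mat_index[OF this Ud(2) that] show ?thesis
      using that Ud(1) by (simp add: Aeq mat_diag_mult_right[OF Ud(1)])
  qed
  have d: "0 \<le> d k" if k: "k < K" for k
  proof -
    \<comment> \<open>Testing positivity on the \<open>k\<close>-th eigenvector, transported to
      \<open>J\<close>, yields the eigenvalue \<open>d k\<close> itself.\<close>
    define z where "z x = U $$ (g x, k)" for x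
    have "(\<Sum>i\<in>J. \<Sum>j\<in>J. cnj (z i) * G i j * z j)
        = (\<Sum>i<K. \<Sum>j<K. cnj (U $$ (i, k)) * A $$ (i, j) * U $$ (j, k))"
      unfolding reidx[symmetric] by (intro sum.cong refl) (simp add: z_def gh A_def)
    also have "\<dots> = (\<Sum>i<K. cnj (U $$ (i, k)) * (A * U) $$ (i, k))"
      using k by (intro sum.cong refl) (simp add: mult_mat_index[OF A Ud(1)] sum_distrib_left mult.assoc)
    also have "\<dots> = (\<Sum>i<K. cnj (U $$ (i, k)) * U $$ (i, k)) * complex_of_real (d k)"
      using k unfolding AU by (simp add: mat_diag_mult_right[OF Ud(1)] sum_distrib_right mult.assoc)
    also have "(\<Sum>i<K. cnj (U $$ (i, k)) * U $$ (i, k)) = (cadj U * U) $$ (k, k)"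
      using k Ud(1) by (subst mult_mat_index[OF Ud(2,1)]) auto
    finally show ?thesis using pos[of z] Ud(3) k by simp
  qed
  define W where "W k x = complex_of_real (sqrt (d k)) * cnj (U $$ (g x, k))" for k x
  have "(\<Sum>k<K. cnj (W k i) * W k j) = G i j" if "i \<in> J" "j \<in> J" for i j
  proof -
    have "(\<Sum>k<K. cnj (W k i) * W k j)
        = (\<Sum>k<K. U $$ (g i, k) * complex_of_real (d k) * cnj (U $$ (g j, k)))"
    proof (intro sum.cong refl)
      fix k assume "k \<in> {..<K}"
      then have "complex_of_real (sqrt (d k)) * complex_of_real (sqrt (d k)) = complex_of_real (d k)"
        using d[of k] by (simp flip: of_real_mult)
      then show "cnj (W k i) * W k j = U $$ (g i, k) * complex_of_real (d k) * cnj (U $$ (g j, k))"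
        by (simp add: W_def mult_ac)
    qed
    also have "\<dots> = A $$ (g i, g j)" using ent hg that by simp
    also have "\<dots> = G i j" using hg that by (simp add: A_def)
    finally show ?thesis .
  qed
  then show ?thesis unfolding K_def by blast
qed

lemma operator_monotone_contraction:
  fixes V :: "'a \<Rightarrow> 'b \<Rightarrow> complex"
  assumes f: "operator_monotone f" and f0: "0 \<le> f 0"
    and I: "finite I" and J: "finite J"
    and a: "\<And>i. i \<in> I \<Longrightarrow> 0 \<le> a i" and b: "\<And>j. j \<in> J \<Longrightarrow> 0 \<le> b j"
    and \<eta>: "0 < \<eta>" "\<eta> < 1"
    and contr: "\<And>z. (\<Sum>i\<in>I. (cmod (\<Sum>j\<in>J. V i j * z j))\<^sup>2) \<le> (\<Sum>j\<in>J. (cmod (z j))\<^sup>2)"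
    and le: "\<And>z. (\<Sum>i\<in>I. a i * (cmod (\<Sum>j\<in>J. V i j * z j))\<^sup>2) \<le> (1 - \<eta>) * (\<Sum>j\<in>J. b j * (cmod (z j))\<^sup>2)"
  shows "(\<Sum>i\<in>I. f (a i) * (cmod (\<Sum>j\<in>J. V i j * z j))\<^sup>2) \<le> (\<Sum>j\<in>J. f (b j) * (cmod (z j))\<^sup>2)"
proof -
  define G where "G i j = (if i = j then 1 else 0) - (\<Sum>k\<in>I. cnj (V k i) * V k j)" for i j
  have "0 \<le> Re (\<Sum>i\<in>J. \<Sum>j\<in>J. cnj (z i) * G i j * z j)" for z
  proof -
    have "(\<Sum>i\<in>J. \<Sum>j\<in>J. cnj (z i) * (if i = j then 1 else 0) * z j) = (\<Sum>i\<in>J. cnj (z i) * z i)"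
      using J by (intro sum.cong refl) (simp add: if_distrib if_distribR cong: if_cong)
    moreover have "(\<Sum>i\<in>J. \<Sum>j\<in>J. cnj (z i) * (\<Sum>k\<in>I. cnj (V k i) * V k j) * z j)
        = (\<Sum>k\<in>I. cnj (\<Sum>j\<in>J. V k j * z j) * (\<Sum>j\<in>J. V k j * z j))"
    proof -
      have "(\<Sum>i\<in>J. \<Sum>j\<in>J. cnj (z i) * (\<Sum>k\<in>I. cnj (V k i) * V k j) * z j)
          = (\<Sum>i\<in>J. \<Sum>j\<in>J. \<Sum>k\<in>I. cnj (V k i * z i) * (V k j * z j))"
        by (simp add: sum_distrib_left sum_distrib_right mult_ac)
      also have "\<dots> = (\<Sum>i\<in>J. \<Sum>k\<in>I. \<Sum>j\<in>J. cnj (V k i * z i) * (V k j * z j))"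
        by (intro sum.cong refl sum.swap)
      also have "\<dots> = (\<Sum>k\<in>I. \<Sum>i\<in>J. \<Sum>j\<in>J. cnj (V k i * z i) * (V k j * z j))"
        by (rule sum.swap)
      finally show ?thesis by (simp only: cnj_sum sum_product)
    qed
    ultimately have "(\<Sum>i\<in>J. \<Sum>j\<in>J. cnj (z i) * G i j * z j)
        = (\<Sum>i\<in>J. cnj (z i) * z i) - (\<Sum>k\<in>I. cnj (\<Sum>j\<in>J. V k j * z j) * (\<Sum>j\<in>J. V k j * z j))"
      by (simp only: G_def right_diff_distrib left_diff_distrib sum_subtractf)
    also have "\<dots> = complex_of_real ((\<Sum>i\<in>J. (cmod (z i))\<^sup>2) - (\<Sum>k\<in>I. (cmod (\<Sum>j\<in>J. V k j * z j))\<^sup>2))"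
      by (simp only: of_real_diff of_real_sum complex_norm_square mult.commute)
    finally show ?thesis using contr[of z] by simp
  qed
  moreover have "G j i = cnj (G i j)" for i j by (simp add: G_def mult.commute)
  ultimately obtain W :: "nat \<Rightarrow> 'b \<Rightarrow> complex"
    where W: "\<And>i j. i \<in> J \<Longrightarrow> j \<in> J \<Longrightarrow> (\<Sum>k<card J. cnj (W k i) * W k j) = G i j"
    using positive_kernel_factorization[OF J, of G] by blast
  define K where "K = I <+> {..<card J}"
  define T where "T = case_sum V W"
  define d :: "'a + nat \<Rightarrow> real" where "d = case_sum a (\<lambda>_. 0)"
  have split: "(\<Sum>w\<in>K. h w) = (\<Sum>w\<in>I. h (Inl w)) + (\<Sum>w<card J. h (Inr w))"
    for h :: "'a + nat \<Rightarrow> 'z::comm_monoid_add"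
    using I by (simp add: sum.Plus K_def)
  have "(\<Sum>k\<in>K. f (d k) * (cmod (\<Sum>j\<in>J. T k j * z j))\<^sup>2) \<le> (\<Sum>j\<in>J. f (b j) * (cmod (z j))\<^sup>2)"
  proof (rule operator_monotone_isometry[OF f f0 J _ _ _ b \<eta>])
    show "finite K" using I by (simp add: K_def)
    show "0 \<le> d k" if "k \<in> K" for k using that a by (auto simp: K_def d_def)
    show "(\<Sum>k\<in>K. cnj (T k i) * T k j) = (if i = j then 1 else 0)" if "i \<in> J" "j \<in> J" for i j
      using W[OF that] by (simp add: split T_def G_def)
    show "(\<Sum>k\<in>K. d k * (cmod (\<Sum>j\<in>J. T k j * z j))\<^sup>2) \<le> (1 - \<eta>) * (\<Sum>j\<in>J. b j * (cmod (z j))\<^sup>2)" for z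
      using le[of z] by (simp add: split T_def d_def)
  qed
  moreover have "0 \<le> (\<Sum>k<card J. f 0 * (cmod (\<Sum>j\<in>J. W k j * z j))\<^sup>2)"
    using f0 by (intro sum_nonneg) simp
  ultimately show ?thesis by (simp add: split T_def d_def)
qed

text \<open>
  Rescaling by \<open>\<surd>p\<close>, \<open>\<surd>q\<close> makes \<open>L\<close> a contraction; a further factor \<open>\<surd>t\<close> with \<open>t < 1\<close> creates the
  slack needed above, and \<open>t\<close> tends to 1 at the end, so continuity of \<open>f\<close> is never needed.
\<close>
lemma operator_monotone_weighted:
  fixes L :: "'a \<Rightarrow> 'b \<Rightarrow> complex"
  assumes f: "operator_monotone f" and f0: "0 \<le> f 0"
    and I: "finite I" and J: "finite J"
    and p: "\<And>i. i \<in> I \<Longrightarrow> 0 < p i" and r: "\<And>i. i \<in> I \<Longrightarrow> 0 \<le> r i"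
    and q: "\<And>j. j \<in> J \<Longrightarrow> 0 < q j" and s: "\<And>j. j \<in> J \<Longrightarrow> 0 \<le> s j"
    and pq: "\<And>y. (\<Sum>i\<in>I. p i * (cmod (\<Sum>j\<in>J. L i j * y j))\<^sup>2) \<le> (\<Sum>j\<in>J. q j * (cmod (y j))\<^sup>2)"
    and rs: "\<And>y. (\<Sum>i\<in>I. r i * (cmod (\<Sum>j\<in>J. L i j * y j))\<^sup>2) \<le> (\<Sum>j\<in>J. s j * (cmod (y j))\<^sup>2)"
  shows "(\<Sum>i\<in>I. p i * f (r i / p i) * (cmod (\<Sum>j\<in>J. L i j * y j))\<^sup>2)
    \<le> (\<Sum>j\<in>J. q j * f (s j / q j) * (cmod (y j))\<^sup>2)"
proof (rule field_le_mult_one_interval)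
  fix t :: real assume t: "0 < t" "t < 1"
  define V where "V i j = complex_of_real (sqrt t * sqrt (p i)) * L i j / complex_of_real (sqrt (q j))" for i j
  define y' where "y' z j = z j / complex_of_real (sqrt (q j))" for z :: "'b \<Rightarrow> complex" and j
  have V: "(cmod (\<Sum>j\<in>J. V i j * z j))\<^sup>2 = t * p i * (cmod (\<Sum>j\<in>J. L i j * y' z j))\<^sup>2"
    if "i \<in> I" for i z
  proof -
    have "(\<Sum>j\<in>J. V i j * z j) = complex_of_real (sqrt t * sqrt (p i)) * (\<Sum>j\<in>J. L i j * y' z j)"
      by (simp add: V_def y'_def sum_distrib_left mult_ac)
    then show ?thesis using p[OF that] t by (simp add: norm_mult power_mult_distrib)
  qed
  have y': "(cmod (z j))\<^sup>2 = q j * (cmod (y' z j))\<^sup>2" if "j \<in> J" for z j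
    using q[OF that] by (simp add: y'_def norm_divide power_divide)
  have sumV: "(\<Sum>i\<in>I. g i * (cmod (\<Sum>j\<in>J. V i j * z j))\<^sup>2)
      = t * (\<Sum>i\<in>I. p i * g i * (cmod (\<Sum>j\<in>J. L i j * y' z j))\<^sup>2)" for g z
    unfolding sum_distrib_left by (intro sum.cong refl) (simp add: V)
  have sumy: "(\<Sum>j\<in>J. g j * (cmod (z j))\<^sup>2) = (\<Sum>j\<in>J. q j * g j * (cmod (y' z j))\<^sup>2)" for g z
    by (intro sum.cong refl) (subst y'[of _ z], simp_all)
  have pr: "p i * (r i / p i) = r i" if "i \<in> I" for i using p[OF that] by simp
  have qs: "q j * (s j / q j) = s j" if "j \<in> J" for j using q[OF that] by simp
  define z where "z j = complex_of_real (sqrt (q j)) * y j" for j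
  have yz: "y' z j = y j" if "j \<in> J" for j using q[OF that] by (simp add: y'_def z_def)
  have "(\<Sum>i\<in>I. f (r i / p i) * (cmod (\<Sum>j\<in>J. V i j * z j))\<^sup>2) \<le> (\<Sum>j\<in>J. f (s j / q j) * (cmod (z j))\<^sup>2)"
  proof (rule operator_monotone_contraction[OF f f0 I J, where \<eta> = "1 - t"])
    fix z
    have "t * (\<Sum>i\<in>I. p i * (cmod (\<Sum>j\<in>J. L i j * y' z j))\<^sup>2)
        \<le> (\<Sum>i\<in>I. p i * (cmod (\<Sum>j\<in>J. L i j * y' z j))\<^sup>2)"
      using t p by (intro mult_left_le_one_le sum_nonneg) (auto simp: less_imp_le)
    also have "\<dots> \<le> (\<Sum>j\<in>J. q j * (cmod (y' z j))\<^sup>2)" by (rule pq)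
    finally show "(\<Sum>i\<in>I. (cmod (\<Sum>j\<in>J. V i j * z j))\<^sup>2) \<le> (\<Sum>j\<in>J. (cmod (z j))\<^sup>2)"
      using sumV[of "\<lambda>_. 1" z] sumy[of "\<lambda>_. 1" z] by simp
    have "t * (\<Sum>i\<in>I. r i * (cmod (\<Sum>j\<in>J. L i j * y' z j))\<^sup>2) \<le> t * (\<Sum>j\<in>J. s j * (cmod (y' z j))\<^sup>2)"
      using t by (intro mult_left_mono rs) auto
    then show "(\<Sum>i\<in>I. r i / p i * (cmod (\<Sum>j\<in>J. V i j * z j))\<^sup>2)
        \<le> (1 - (1 - t)) * (\<Sum>j\<in>J. s j / q j * (cmod (z j))\<^sup>2)"
      unfolding sumV sumy[of _ z] by (simp add: pr qs cong: sum.cong del: times_divide_eq_right)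
  qed (use t p q r s in \<open>auto simp: less_imp_le\<close>)
  then show "t * (\<Sum>i\<in>I. p i * f (r i / p i) * (cmod (\<Sum>j\<in>J. L i j * y j))\<^sup>2)
    \<le> (\<Sum>j\<in>J. q j * f (s j / q j) * (cmod (y j))\<^sup>2)"
    unfolding sumV sumy[of _ z] by (simp add: yz)
qed

section \<open>Schwarz inequalities for the adjoint of a completely positive map\<close>

lemma mtrace_mult_comm:
  assumes "A \<in> carrier_mat n m" "B \<in> carrier_mat m n"
  shows "mtrace (A * B) = mtrace (B * A)"
proof -
  have "mtrace (A * B) = (\<Sum>i<n. \<Sum>j<m. A $$ (i, j) * B $$ (j, i))"
    using assms by (simp add: mtrace_def mult_mat_index[OF assms] del: index_mult_mat(1))
  also have "\<dots> = (\<Sum>j<m. \<Sum>i<n. B $$ (j, i) * A $$ (i, j))"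
    by (subst sum.swap) (simp add: mult.commute)
  also have "\<dots> = mtrace (B * A)"
    using assms by (simp add: mtrace_def mult_mat_index[OF assms(2,1)] del: index_mult_mat(1))
  finally show ?thesis .
qed

lemma mtrace_cadj: "A \<in> carrier_mat n n \<Longrightarrow> mtrace (cadj A) = cnj (mtrace A)"
  by (simp add: mtrace_def)

lemma hs_inner_sum:
  assumes "X \<in> carrier_mat n m" "Y \<in> carrier_mat n m"
  shows "hs_inner X Y = (\<Sum>p\<in>{..<n} \<times> {..<m}. cnj (X $$ p) * Y $$ p)"
proof -
  have "hs_inner X Y = (\<Sum>j<m. \<Sum>i<n. cnj (X $$ (i, j)) * Y $$ (i, j))"
    using assms
    by (simp add: hs_inner_def mtrace_def mult_mat_index[OF cadj_carrier[OF assms(1)] assms(2)]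
        del: index_mult_mat(1))
  also have "\<dots> = (\<Sum>i<n. \<Sum>j<m. cnj (X $$ (i, j)) * Y $$ (i, j))"
    by (rule sum.swap)
  finally show ?thesis by (simp add: sum.cartesian_product split_def)
qed

lemma hs_inner_cnj:
  assumes "X \<in> carrier_mat n m" "Y \<in> carrier_mat n m"
  shows "hs_inner Y X = cnj (hs_inner X Y)"
  by (simp add: hs_inner_sum[OF assms] hs_inner_sum[OF assms(2,1)] mult.commute)

definition unit_mat :: "nat \<Rightarrow> nat \<times> nat \<Rightarrow> complex mat" where
  "unit_mat n p = mat n n (\<lambda>q. if q = p then 1 else 0)"

lemma unit_mat_carrier [simp]: "unit_mat n p \<in> carrier_mat n n"
  by (simp add: unit_mat_def)

text \<open>Induction on the set \<open>S\<close> of entries that are kept, all others being set to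
  zero. The expansion reduces statements about linear maps on the carrier to matrix units; it yields
  the adjoint here and the coordinate matrix of \<open>\<beta>\<^sup>*\<close> later.\<close>

lemma linear_functional_expand:
  fixes \<phi> :: "complex mat \<Rightarrow> complex"
  assumes add: "\<And>X Y. X \<in> carrier_mat n n \<Longrightarrow> Y \<in> carrier_mat n n \<Longrightarrow> \<phi> (X + Y) = \<phi> X + \<phi> Y"
    and smult: "\<And>c X. X \<in> carrier_mat n n \<Longrightarrow> \<phi> (c \<cdot>\<^sub>m X) = c * \<phi> X"
    and X: "X \<in> carrier_mat n n"
  shows "\<phi> X = (\<Sum>p\<in>{..<n} \<times> {..<n}. X $$ p * \<phi> (unit_mat n p))"
proof -
  have *: "\<phi> (mat n n (\<lambda>q. if q \<in> S then X $$ q else 0)) = (\<Sum>p\<in>S. X $$ p * \<phi> (unit_mat n p))"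
    if "finite S" for S
    using that
  proof (induction S)
    case empty
    have "mat n n (\<lambda>q. if q \<in> {} then X $$ q else 0) = 0 \<cdot>\<^sub>m X"
      by (rule eq_matI) (use X in auto)
    then show ?case using smult[OF X, of 0] by simp
  next
    case (insert p S)
    have "mat n n (\<lambda>q. if q \<in> insert p S then X $$ q else 0)
        = X $$ p \<cdot>\<^sub>m unit_mat n p + mat n n (\<lambda>q. if q \<in> S then X $$ q else 0)"
      by (rule eq_matI) (use insert.hyps in \<open>auto simp: unit_mat_def\<close>)
    then show ?case using insert by (simp add: add smult)
  qed
  have "mat n n (\<lambda>q. if q \<in> {..<n} \<times> {..<n} then X $$ q else 0) = X"
    by (rule eq_matI) (use X in auto)
  then show ?thesis using *[of "{..<n} \<times> {..<n}"] by simp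
qed

lemma hs_inner_unit_mat:
  assumes "Z \<in> carrier_mat n n" "p \<in> {..<n} \<times> {..<n}"
  shows "hs_inner Z (unit_mat n p) = cnj (Z $$ p)"
proof -
  have "hs_inner Z (unit_mat n p) = (\<Sum>q\<in>{..<n} \<times> {..<n}. if q = p then cnj (Z $$ q) else 0)"
    unfolding hs_inner_sum[OF assms(1) unit_mat_carrier]
    by (intro sum.cong refl) (auto simp: unit_mat_def)
  then show ?thesis using assms(2) by simp
qed

lemma hs_inner_eqI:
  assumes "Z \<in> carrier_mat n n" "Z' \<in> carrier_mat n n"
    and "\<And>X. X \<in> carrier_mat n n \<Longrightarrow> hs_inner Z X = hs_inner Z' X"
  shows "Z = Z'"
proof (rule eq_matI)
  fix i j assume "i < dim_row Z'" "j < dim_col Z'"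
  then have "(i, j) \<in> {..<n} \<times> {..<n}" using assms(2) by auto
  then show "Z $$ (i, j) = Z' $$ (i, j)"
    using hs_inner_unit_mat[of _ n "(i, j)"] assms by (metis complex_cnj_cancel_iff unit_mat_carrier)
qed (use assms in auto)

lemma hs_inner_add_right:
  assumes "X \<in> carrier_mat n m" "Y \<in> carrier_mat n m" "Z \<in> carrier_mat n m"
  shows "hs_inner X (Y + Z) = hs_inner X Y + hs_inner X Z"
proof -
  have "Y + Z \<in> carrier_mat n m" using assms by auto
  have "hs_inner X (Y + Z) = (\<Sum>p\<in>{..<n} \<times> {..<m}. cnj (X $$ p) * Y $$ p + cnj (X $$ p) * Z $$ p)"
    unfolding hs_inner_sum[OF assms(1) \<open>Y + Z \<in> carrier_mat n m\<close>]
    by (intro sum.cong refl) (use assms in \<open>auto simp: distrib_left\<close>)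
  then show ?thesis
    by (simp only: hs_inner_sum[OF assms(1,2)] hs_inner_sum[OF assms(1,3)] sum.distrib)
qed

lemma hs_inner_minus_right:
  assumes "X \<in> carrier_mat n m" "Y \<in> carrier_mat n m" "Z \<in> carrier_mat n m"
  shows "hs_inner X (Y - Z) = hs_inner X Y - hs_inner X Z"
proof -
  have "Y - Z \<in> carrier_mat n m" using assms by auto
  have "hs_inner X (Y - Z) = (\<Sum>p\<in>{..<n} \<times> {..<m}. cnj (X $$ p) * Y $$ p - cnj (X $$ p) * Z $$ p)"
    unfolding hs_inner_sum[OF assms(1) \<open>Y - Z \<in> carrier_mat n m\<close>]
    by (intro sum.cong refl) (use assms in \<open>auto simp: right_diff_distrib\<close>)
  then show ?thesis
    by (simp only: hs_inner_sum[OF assms(1,2)] hs_inner_sum[OF assms(1,3)] sum_subtractf)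
qed

lemma hs_inner_smult_right:
  assumes "X \<in> carrier_mat n m" "Y \<in> carrier_mat n m"
  shows "hs_inner X (c \<cdot>\<^sub>m Y) = c * hs_inner X Y"
proof -
  have "c \<cdot>\<^sub>m Y \<in> carrier_mat n m" using assms by simp
  from hs_inner_sum[OF assms(1) this] show ?thesis
    unfolding hs_inner_sum[OF assms] sum_distrib_left using assms by (auto intro!: sum.cong)
qed

text \<open>Riesz representation in finite dimension: testing on matrix units forces the entry at
  \<open>p\<close> to be the conjugate of \<open>hs_inner Y (T (unit_mat n p))\<close>, and
  linearity shows that this choice works for every \<open>X\<close>. Thus the \<open>THE\<close> in
  \<open>hs_adjoint\<close> is well defined.\<close>

lemma hs_adjoint:
  assumes T: "lin_map n m T" and Y: "Y \<in> carrier_mat m m"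
  shows "hs_adjoint n m T Y \<in> carrier_mat n n"
    and "\<And>X. X \<in> carrier_mat n n \<Longrightarrow> hs_inner (hs_adjoint n m T Y) X = hs_inner Y (T X)"
proof -
  define Z where "Z = mat n n (\<lambda>p. cnj (hs_inner Y (T (unit_mat n p))))"
  have Z: "Z \<in> carrier_mat n n" by (simp add: Z_def)
  have eq: "hs_inner Z X = hs_inner Y (T X)" if X: "X \<in> carrier_mat n n" for X
  proof -
    have "hs_inner Y (T X) = (\<Sum>p\<in>{..<n} \<times> {..<n}. X $$ p * hs_inner Y (T (unit_mat n p)))"
      by (rule linear_functional_expand[OF _ _ X, of "\<lambda>X. hs_inner Y (T X)"])
        (use T Y in \<open>auto simp: lin_map_def hs_inner_add_right[of _ m m] hs_inner_smult_right[of _ m m]\<close>)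
    also have "\<dots> = hs_inner Z X"
      unfolding hs_inner_sum[OF Z X] by (intro sum.cong refl) (auto simp: Z_def)
    finally show ?thesis by simp
  qed
  have "hs_adjoint n m T Y = Z" unfolding hs_adjoint_def
    by (rule the_equality) (use Z eq in \<open>auto intro!: hs_inner_eqI[of _ n]\<close>)
  then show "hs_adjoint n m T Y \<in> carrier_mat n n"
    and "\<And>X. X \<in> carrier_mat n n \<Longrightarrow> hs_inner (hs_adjoint n m T Y) X = hs_inner Y (T X)"
    using Z eq by simp_all
qed

text \<open>The defining relation has the adjoint in the conjugate-linear slot. Moving it to the
  second slot (\<open>flip\<close>) lets linearity of the inner product carry over.\<close>

lemma hs_adjoint_lin_map:
  assumes T: "lin_map n m T"
  shows "lin_map m n (hs_adjoint n m T)"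
proof -
  note adj = hs_adjoint[OF T]
  have TX: "T X \<in> carrier_mat m m" if "X \<in> carrier_mat n n" for X
    using T that by (simp add: lin_map_def)
  have flip: "hs_inner X (hs_adjoint n m T Y) = hs_inner (T X) Y"
    if "X \<in> carrier_mat n n" "Y \<in> carrier_mat m m" for X Y
    using that adj TX by (metis hs_inner_cnj)
  have eqI: "A = B" if "A \<in> carrier_mat n n" "B \<in> carrier_mat n n"
    "\<And>X. X \<in> carrier_mat n n \<Longrightarrow> hs_inner X A = hs_inner X B" for A B
    using that by (intro hs_inner_eqI) (auto simp: hs_inner_cnj[of _ n n A] hs_inner_cnj[of _ n n B])
  show ?thesis unfolding lin_map_def
  proof (intro conjI ballI allI)
    fix X Y :: "complex mat" assume XY: "X \<in> carrier_mat m m" "Y \<in> carrier_mat m m"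
    show "hs_adjoint n m T (X + Y) = hs_adjoint n m T X + hs_adjoint n m T Y"
      using XY adj(1) TX
      by (intro eqI) (auto simp: hs_inner_add_right[of _ n n] hs_inner_add_right[of _ m m] flip)
  next
    fix X :: "complex mat" and c assume X: "X \<in> carrier_mat m m"
    show "hs_adjoint n m T (c \<cdot>\<^sub>m X) = c \<cdot>\<^sub>m hs_adjoint n m T X"
      using X adj(1) TX
      by (intro eqI) (auto simp: hs_inner_smult_right[of _ n n] hs_inner_smult_right[of _ m m] flip)
  qed (use adj in auto)
qed

section \<open>Block matrices and complete positivity\<close>

lemma psd_mat_conj:
  assumes D: "psd_mat n D" and C: "C \<in> carrier_mat k n"
  shows "psd_mat k (C * D * cadj C)"
proof -
  have Dc: "D \<in> carrier_mat n n" and Dh: "cadj D = D" using D by (auto simp: psd_mat_def hermitian_def)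
  have "cadj (C * D * cadj C) = C * D * cadj C"
    using C Dc Dh by (simp add: cadj_mult mult_mat_assoc)
  moreover have "qform (C * D * cadj C) v = qform D (cadj C *\<^sub>v v)" if v: "v \<in> carrier_vec k" for v
  proof -
    have w: "cadj C *\<^sub>v v \<in> carrier_vec n" using C v by (intro mult_mat_vec_carrier[of _ n k]) auto
    have DC: "D * cadj C \<in> carrier_mat n k" using Dc C by auto
    have "qform (C * D * cadj C) v = qform (cadj (cadj C) * (D * cadj C)) v"
      using C Dc by (simp add: mult_mat_assoc)
    also have "\<dots> = (\<Sum>i<n. cnj ((cadj C *\<^sub>v v) $ i) * ((D * cadj C) *\<^sub>v v) $ i)"
      by (rule qform_cadj_mult[OF cadj_carrier[OF C] DC v])
    also have "(D * cadj C) *\<^sub>v v = D *\<^sub>v (cadj C *\<^sub>v v)"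
      using C Dc v by (simp add: mult_mat_vec_assoc)
    finally show ?thesis using C by (simp add: qform_def del: index_mult_mat_vec)
  qed
  ultimately show ?thesis
    using D C Dc mult_mat_vec_carrier[OF cadj_carrier[OF C]]
    by (auto simp: psd_mat_def hermitian_def)
qed

lemma sum_lessThan_mult:
  "(\<Sum>x<r * m. h x) = (\<Sum>i<r. \<Sum>a<m. h (i * m + a))" for h :: "nat \<Rightarrow> 'a::comm_monoid_add"
proof -
  have "(\<Sum>x\<in>{i * m..<i * m + m}. h x) = (\<Sum>a<m. h (i * m + a))" for i
    using sum.shift_bounds_nat_ivl[of h 0 "i * m" m]
    by (simp add: atLeast0LessThan add.commute)
  then show ?thesis by (simp flip: sum.nat_group)
qed

text \<open>Stacking the \<open>Z i\<close> into one column \<open>C\<close> gives the positive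
  matrix \<open>C * D * cadj C\<close> with blocks \<open>Z i * D * cadj (Z j)\<close>. Its image
  under the amplification is positive: being Hermitian gives the second claim, and its quadratic
  form gives the first.\<close>

lemma completely_positive_blocks:
  fixes Z Y :: "nat \<Rightarrow> complex mat"
  assumes cp: "completely_positive n m \<beta>" and D: "psd_mat n D"
    and Z: "\<And>i. Z i \<in> carrier_mat n n" and Y: "\<And>i. Y i \<in> carrier_mat m m"
  shows "0 \<le> Re (\<Sum>i<r. \<Sum>j<r. mtrace (cadj (Y i) * \<beta> (Z i * D * cadj (Z j)) * Y j))"
    and "i < r \<Longrightarrow> j < r \<Longrightarrow> cadj (\<beta> (Z i * D * cadj (Z j))) = \<beta> (Z j * D * cadj (Z i))"
proof -
  have lin: "lin_map n m \<beta>" using cp by (simp add: completely_positive_def)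
  have Dc: "D \<in> carrier_mat n n" using D by (simp add: psd_mat_def)
  define B where "B i j = \<beta> (Z i * D * cadj (Z j))" for i j
  have ZDZ: "Z i * D * cadj (Z j) \<in> carrier_mat n n" for i j using Z[of i] Z[of j] Dc by auto
  have B: "B i j \<in> carrier_mat m m" for i j
    using lin ZDZ by (simp add: lin_map_def B_def)
  define C where "C = mat (r * n) n (\<lambda>(a, b). Z (a div n) $$ (a mod n, b))"
  have C: "C \<in> carrier_mat (r * n) n" by (simp add: C_def)
  define P where "P = C * D * cadj C"
  have idx: "i * k + a < r * k" if "i < r" "a < k" for i a k :: nat
  proof -
    have "i * k + a < Suc i * k" using that by simp
    also have "\<dots> \<le> r * k" using that by (intro mult_le_mono1) auto
    finally show ?thesis .
  qed
  have blk: "blk n P i j = Z i * D * cadj (Z j)" if ij: "i < r" "j < r" for i j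
  proof (rule eq_matI)
    fix a b assume "a < dim_row (Z i * D * cadj (Z j))" "b < dim_col (Z i * D * cadj (Z j))"
    then have ab: "a < n" "b < n" using Z[of i] Z[of j] by auto
    note ia = idx[OF ij(1) ab(1)] and jb = idx[OF ij(2) ab(2)]
    have CD: "C * D \<in> carrier_mat (r * n) n" and ZD: "Z i * D \<in> carrier_mat n n"
      using C Dc Z[of i] by auto
    have Cent: "C $$ (i * n + a, k) = Z i $$ (a, k)" "C $$ (j * n + b, k) = Z j $$ (b, k)" if "k < n" for k
      using that ia jb ab by (simp_all add: C_def)
    have "(C * D) $$ (i * n + a, k) = (Z i * D) $$ (a, k)" if "k < n" for k
      unfolding mult_mat_index[OF C Dc ia that] mult_mat_index[OF Z Dc ab(1) that]
      by (simp add: Cent)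
    then have "P $$ (i * n + a, j * n + b) = (Z i * D * cadj (Z j)) $$ (a, b)"
      unfolding P_def mult_mat_index[OF CD cadj_carrier[OF C] ia jb]
        mult_mat_index[OF ZD cadj_carrier[OF Z] ab]
      using C Z[of j] jb ab by (intro sum.cong refl) (simp add: Cent del: index_mult_mat)
    then show "blk n P i j $$ (a, b) = (Z i * D * cadj (Z j)) $$ (a, b)"
      using ab by (simp add: blk_def)
  qed (use Z[of i] Z[of j] in \<open>auto simp: blk_def\<close>)
  define A where "A = ampl r n m \<beta> P"
  have A: "A \<in> carrier_mat (r * m) (r * m)" by (simp add: A_def ampl_def)
  have Aent: "A $$ (i * m + a, j * m + b) = B i j $$ (a, b)"
    if "i < r" "j < r" "a < m" "b < m" for i j a b
    using that idx by (simp add: A_def ampl_def B_def blk)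
  have psdA: "psd_mat (r * m) A"
    using cp psd_mat_conj[OF D C] unfolding completely_positive_def A_def P_def by blast
  show "cadj (\<beta> (Z i * D * cadj (Z j))) = \<beta> (Z j * D * cadj (Z i))" if ij: "i < r" "j < r"
  proof -
    have "cadj (B i j) = B j i"
    proof (rule eq_matI)
      fix a b assume "a < dim_row (B j i)" "b < dim_col (B j i)"
      then have ab: "a < m" "b < m" using B[of j i] by auto
      have "cadj A = A" using psdA by (simp add: psd_mat_def hermitian_def)
      then have "cadj A $$ (j * m + a, i * m + b) = A $$ (j * m + a, i * m + b)" by simp
      then show "cadj (B i j) $$ (a, b) = B j i $$ (a, b)"
        using A B[of i j] ij ab idx by (simp add: Aent)
    qed (use B[of i j] B[of j i] in auto)
    then show ?thesis by (simp add: B_def)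
  qed
  \<comment> \<open>The \<open>c\<close>-th column of the stacked \<open>Y i\<close>. The quadratic
    forms at these vectors, summed over \<open>c\<close>, assemble to the traces.\<close>
  define v where "v c = vec (r * m) (\<lambda>a. Y (a div m) $$ (a mod m, c))" for c
  have v: "v c \<in> carrier_vec (r * m)" for c by (simp add: v_def)
  have vent: "v c $ (i * m + a) = Y i $$ (a, c)" if "i < r" "a < m" for i a c
    using that idx by (simp add: v_def)
  have q: "qform A (v c) = (\<Sum>i<r. \<Sum>j<r. \<Sum>a<m. \<Sum>b<m. cnj (Y i $$ (a, c)) * (B i j $$ (a, b) * Y j $$ (b, c)))" for c
  proof -
    have "qform A (v c) = (\<Sum>x<r * m. cnj (v c $ x) * (\<Sum>y<r * m. A $$ (x, y) * v c $ y))"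
      unfolding qform_def using v[of c] mult_mat_vec_index[OF A v] by simp
    also have "\<dots> = (\<Sum>i<r. \<Sum>a<m. \<Sum>j<r. \<Sum>b<m. cnj (Y i $$ (a, c)) * (B i j $$ (a, b) * Y j $$ (b, c)))"
      unfolding sum_lessThan_mult sum_distrib_left by (intro sum.cong refl) (simp add: vent Aent)
    also have "\<dots> = (\<Sum>i<r. \<Sum>j<r. \<Sum>a<m. \<Sum>b<m. cnj (Y i $$ (a, c)) * (B i j $$ (a, b) * Y j $$ (b, c)))"
      by (intro sum.cong refl sum.swap)
    finally show ?thesis .
  qed
  have tr: "mtrace (cadj (Y i) * B i j * Y j)
      = (\<Sum>c<m. \<Sum>a<m. \<Sum>b<m. cnj (Y i $$ (a, c)) * (B i j $$ (a, b) * Y j $$ (b, c)))" for i j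
  proof -
    have BY: "B i j * Y j \<in> carrier_mat m m" using B[of i j] Y[of j] by auto
    have "mtrace (cadj (Y i) * B i j * Y j) = mtrace (cadj (Y i) * (B i j * Y j))"
      using B[of i j] Y[of j] Y[of i] by (simp add: mult_mat_assoc)
    also have "\<dots> = (\<Sum>c<m. (cadj (Y i) * (B i j * Y j)) $$ (c, c))"
      using Y[of i] by (simp add: mtrace_def)
    also have "\<dots> = (\<Sum>c<m. \<Sum>a<m. \<Sum>b<m. cnj (Y i $$ (a, c)) * (B i j $$ (a, b) * Y j $$ (b, c)))"
      using Y[of i]
      by (intro sum.cong refl)
        (simp add: mult_mat_index[OF cadj_carrier[OF Y] BY] mult_mat_index[OF B Y] sum_distrib_left
          del: index_mult_mat(1))
    finally show ?thesis .
  qed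
  have "0 \<le> (\<Sum>c<m. Re (qform A (v c)))"
    using psdA v by (intro sum_nonneg) (auto simp: psd_mat_def)
  also have "\<dots> = Re (\<Sum>i<r. \<Sum>j<r. mtrace (cadj (Y i) * B i j * Y j))"
  proof -
    have "(\<Sum>c<m. qform A (v c)) = (\<Sum>i<r. \<Sum>j<r. mtrace (cadj (Y i) * B i j * Y j))"
      unfolding q tr by (rule trans[OF sum.swap sum.cong[OF refl sum.swap]])
    then show ?thesis by (simp flip: Re_sum)
  qed
  finally show "0 \<le> Re (\<Sum>i<r. \<Sum>j<r. mtrace (cadj (Y i) * \<beta> (Z i * D * cadj (Z j)) * Y j))"
    by (simp add: B_def)
qed

lemma psd_mat_one: "psd_mat n (1\<^sub>m n)"
  by (auto simp: psd_mat_def hermitian_def qform_def intro!: sum_nonneg add_nonneg_nonneg)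

text \<open>For \<open>D = 1\<close> and the column with blocks \<open>X\<close> and
  \<open>1\<close>, the off-diagonal blocks are \<open>X\<close> and \<open>cadj X\<close>.\<close>

lemma completely_positive_cadj:
  assumes cp: "completely_positive n m \<beta>" and X: "X \<in> carrier_mat n n"
  shows "\<beta> (cadj X) = cadj (\<beta> X)"
  using completely_positive_blocks(2)[OF cp psd_mat_one, of "\<lambda>i. if i = 0 then X else 1\<^sub>m n" "\<lambda>_. 1\<^sub>m m" 0 2 1] X
  by simp

lemma hs_adjoint_cadj:
  assumes cp: "completely_positive n m \<beta>" and Y: "Y \<in> carrier_mat m m"
  shows "hs_adjoint n m \<beta> (cadj Y) = cadj (hs_adjoint n m \<beta> Y)"
proof -
  have lin: "lin_map n m \<beta>" using cp by (simp add: completely_positive_def)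
  have flip: "hs_inner (cadj A) B = cnj (hs_inner A (cadj B))"
    if "A \<in> carrier_mat k k" "B \<in> carrier_mat k k" for A B k
  proof -
    have "cadj A * cadj B \<in> carrier_mat k k" using that by auto
    from mtrace_cadj[OF this] have "cnj (hs_inner A (cadj B)) = mtrace (B * A)"
      using that by (simp add: hs_inner_def cadj_mult)
    then show ?thesis using that mtrace_mult_comm[of A k k B] by (simp add: hs_inner_def)
  qed
  note adj = hs_adjoint[OF lin]
  have "\<beta> X \<in> carrier_mat m m" if "X \<in> carrier_mat n n" for X
    using lin that by (simp add: lin_map_def)
  then show ?thesis
    using adj(1)[OF Y] adj(1)[OF cadj_carrier[OF Y]] adj(2)[OF Y] adj(2)[OF cadj_carrier[OF Y]] Y
    by (intro hs_inner_eqI[of _ n])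
      (auto simp: flip[of _ n] flip[of _ m] completely_positive_cadj[OF cp])
qed

text \<open>Expanding the block form gives four traces. By the adjoint relation each of the two
  cross terms has real part \<open>- Re (hs_inner W (D * W))\<close>; by trace preservation the last
  corner contributes the same quantity with a plus sign. One copy with a minus sign survives against
  \<open>hs_inner Y (\<beta> D * Y)\<close>.\<close>

lemma adjoint_Schwarz_left:
  assumes cp: "completely_positive n m \<beta>" and tp: "trace_preserving n \<beta>" and D: "psd_mat n D"
    and Y: "Y \<in> carrier_mat m m"
  shows "Re (hs_inner (hs_adjoint n m \<beta> Y) (D * hs_adjoint n m \<beta> Y)) \<le> Re (hs_inner Y (\<beta> D * Y))"
proof -
  have lin: "lin_map n m \<beta>" using cp by (simp add: completely_positive_def)
  have \<beta>c: "\<beta> X \<in> carrier_mat m m" if "X \<in> carrier_mat n n" for X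
    using lin that by (simp add: lin_map_def)
  have Dc: "D \<in> carrier_mat n n" and Dh: "cadj D = D" using D by (auto simp: psd_mat_def hermitian_def)
  define W where "W = hs_adjoint n m \<beta> Y"
  have W: "W \<in> carrier_mat n n" unfolding W_def by (rule hs_adjoint(1)[OF lin Y])
  have adj: "hs_inner W X = hs_inner Y (\<beta> X)" if "X \<in> carrier_mat n n" for X
    unfolding W_def by (rule hs_adjoint(2)[OF lin Y that])
  have DW: "D * W \<in> carrier_mat n n" using Dc W by auto
  have WDW: "cadj W * D * W \<in> carrier_mat n n" using Dc W by auto
  \<comment> \<open>Test the image of the positive block matrix \<open>(1, W)\<^sup>* D (1, W)\<close> on \<open>(Y, -1)\<close>.\<close>
  define Z where "Z i = (if i = 0 then 1\<^sub>m n else cadj W)" for i :: nat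
  define Y' where "Y' i = (if i = 0 then Y else - 1\<^sub>m m)" for i :: nat
  have neg: "cadj (- 1\<^sub>m m) = - 1\<^sub>m m" by (rule eq_matI) auto
  have trneg: "mtrace (- A) = - mtrace A" if "A \<in> carrier_mat m m" for A
    using that by (simp add: mtrace_def sum_negf)
  have t00: "mtrace (cadj Y * \<beta> D * Y) = hs_inner Y (\<beta> D * Y)"
    using Y \<beta>c[OF Dc] by (simp add: hs_inner_def mult_mat_assoc)
  have t01: "mtrace (cadj Y * \<beta> (D * W) * - 1\<^sub>m m) = - hs_inner W (D * W)"
  proof -
    have c: "cadj Y * \<beta> (D * W) \<in> carrier_mat m m" using Y \<beta>c[OF DW] by auto
    then have "cadj Y * \<beta> (D * W) * - 1\<^sub>m m = - (cadj Y * \<beta> (D * W))"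
      using \<beta>c[OF DW] by simp
    then show ?thesis using trneg[OF c] adj[OF DW] by (simp add: hs_inner_def)
  qed
  have t10: "mtrace (- 1\<^sub>m m * \<beta> (cadj W * D) * Y) = - cnj (hs_inner W (D * W))"
  proof -
    have WD: "cadj W * D = cadj (D * W)" using Dc Dh W by (simp add: cadj_mult)
    have c: "cadj (\<beta> (D * W)) * Y \<in> carrier_mat m m" using Y \<beta>c[OF DW] by auto
    have "- 1\<^sub>m m * \<beta> (cadj W * D) * Y = - (cadj (\<beta> (D * W)) * Y)"
      using \<beta>c[OF DW] Y unfolding WD completely_positive_cadj[OF cp DW] by simp
    then have "mtrace (- 1\<^sub>m m * \<beta> (cadj W * D) * Y) = - hs_inner (\<beta> (D * W)) Y"
      using trneg[OF c] by (simp add: hs_inner_def)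
    then show ?thesis using adj[OF DW] hs_inner_cnj[OF Y \<beta>c[OF DW]] by simp
  qed
  have t11: "mtrace (- 1\<^sub>m m * \<beta> (cadj W * D * W) * - 1\<^sub>m m) = hs_inner W (D * W)"
  proof -
    have "- 1\<^sub>m m * \<beta> (cadj W * D * W) * - 1\<^sub>m m = \<beta> (cadj W * D * W)"
      using \<beta>c[OF WDW] by simp
    then show ?thesis using tp WDW W Dc
      by (simp add: trace_preserving_def hs_inner_def mult_mat_assoc)
  qed
  have "0 \<le> Re (\<Sum>i<2. \<Sum>j<2. mtrace (cadj (Y' i) * \<beta> (Z i * D * cadj (Z j)) * Y' j))"
    by (rule completely_positive_blocks(1)[OF cp D]) (use W Y in \<open>auto simp: Z_def Y'_def\<close>)
  also have "(\<Sum>i<2. \<Sum>j<2. mtrace (cadj (Y' i) * \<beta> (Z i * D * cadj (Z j)) * Y' j))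
      = mtrace (cadj Y * \<beta> D * Y) + mtrace (cadj Y * \<beta> (D * W) * - 1\<^sub>m m)
        + (mtrace (- 1\<^sub>m m * \<beta> (cadj W * D) * Y) + mtrace (- 1\<^sub>m m * \<beta> (cadj W * D * W) * - 1\<^sub>m m))"
    using Dc W by (simp add: numeral_2_eq_2 Z_def Y'_def neg)
  finally show ?thesis unfolding t00 t01 t10 t11 by (simp add: W_def)
qed

text \<open>The left version applied to \<open>cadj Y\<close>: \<open>\<beta>\<^sup>*\<close>
  commutes with \<open>cadj\<close>, and cyclicity of the trace moves the density to the other
  side.\<close>

lemma adjoint_Schwarz_right:
  assumes cp: "completely_positive n m \<beta>" and tp: "trace_preserving n \<beta>" and D: "psd_mat n D"
    and Y: "Y \<in> carrier_mat m m"
  shows "Re (hs_inner (hs_adjoint n m \<beta> Y) (hs_adjoint n m \<beta> Y * D)) \<le> Re (hs_inner Y (Y * \<beta> D))"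
proof -
  have lin: "lin_map n m \<beta>" using cp by (simp add: completely_positive_def)
  have Dc: "D \<in> carrier_mat n n" using D by (simp add: psd_mat_def)
  then have \<beta>D: "\<beta> D \<in> carrier_mat m m" using lin by (simp add: lin_map_def)
  have swap: "hs_inner (cadj A) (B * cadj A) = hs_inner A (A * B)"
    if "A \<in> carrier_mat k k" "B \<in> carrier_mat k k" for A B k
    using that mtrace_mult_comm[of "A * B" k k "cadj A"] by (simp add: hs_inner_def mult_mat_assoc)
  show ?thesis
    using adjoint_Schwarz_left[OF cp tp D cadj_carrier[OF Y]]
    unfolding hs_adjoint_cadj[OF cp Y] swap[OF hs_adjoint(1)[OF lin Y] Dc] swap[OF Y \<beta>D] .
qed

section \<open>Eigenbasis coordinates\<close>

text \<open>Rows are expanded in the basis \<open>U\<close> and columns in \<open>V\<close>. Left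
  multiplication by a Hermitian matrix diagonalized by \<open>U\<close> then scales rows, and right
  multiplication by a matrix diagonalized by \<open>V\<close> scales columns.\<close>

definition coords :: "complex mat \<Rightarrow> complex mat \<Rightarrow> complex mat \<Rightarrow> complex mat" where
  "coords U V X = cadj U * X * V"

definition of_coords :: "complex mat \<Rightarrow> complex mat \<Rightarrow> complex mat \<Rightarrow> complex mat" where
  "of_coords U V M = U * M * cadj V"

context
  fixes n :: nat and U V :: "complex mat"
  assumes U: "unitary_mat n U" and V: "unitary_mat n V"
begin

lemma coords_carrier [simp]: "X \<in> carrier_mat n n \<Longrightarrow> coords U V X \<in> carrier_mat n n"
  using unitary_matD(1)[OF U] unitary_matD(1)[OF V] by (auto simp: coords_def)

lemma of_coords_carrier [simp]: "M \<in> carrier_mat n n \<Longrightarrow> of_coords U V M \<in> carrier_mat n n"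
  using unitary_matD(1)[OF U] unitary_matD(1)[OF V] by (auto simp: of_coords_def)

lemma of_coords_coords [simp]:
  assumes "X \<in> carrier_mat n n"
  shows "of_coords U V (coords U V X) = X"
proof -
  note Ud = unitary_matD[OF U] and Vd = unitary_matD[OF V]
  have "of_coords U V (coords U V X) = U * cadj U * X * (V * cadj V)"
    using assms Ud(1) Vd(1) by (simp add: of_coords_def coords_def mult_mat_assoc)
  then show ?thesis using assms Ud Vd by simp
qed

lemma coords_of_coords [simp]:
  assumes "M \<in> carrier_mat n n"
  shows "coords U V (of_coords U V M) = M"
proof -
  note Ud = unitary_matD[OF U] and Vd = unitary_matD[OF V]
  have "coords U V (of_coords U V M) = cadj U * U * M * (cadj V * V)"
    using assms Ud(1) Vd(1) by (simp add: of_coords_def coords_def mult_mat_assoc)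
  then show ?thesis using assms Ud Vd by simp
qed

lemma coords_add:
  assumes "X \<in> carrier_mat n n" "Y \<in> carrier_mat n n"
  shows "coords U V (X + Y) = coords U V X + coords U V Y"
proof -
  note Ud = unitary_matD[OF U] and Vd = unitary_matD[OF V]
  have "cadj U * X \<in> carrier_mat n n" "cadj U * Y \<in> carrier_mat n n" using Ud(2) assms by auto
  then show ?thesis
    using Vd(1) by (simp add: coords_def mult_add_distrib_mat[OF Ud(2) assms] add_mult_distrib_mat)
qed

lemma coords_smult:
  assumes "X \<in> carrier_mat n n"
  shows "coords U V (c \<cdot>\<^sub>m X) = c \<cdot>\<^sub>m coords U V X"
proof -
  note Ud = unitary_matD[OF U] and Vd = unitary_matD[OF V]
  have "cadj U * X \<in> carrier_mat n n" using Ud(2) assms by auto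
  then show ?thesis
    using Vd(1) by (simp add: coords_def mult_smult_distrib[OF Ud(2) assms] mult_smult_assoc_mat)
qed

lemma coords_eqI:
  assumes "X \<in> carrier_mat n n" "Y \<in> carrier_mat n n"
    and "\<And>p. p \<in> {..<n} \<times> {..<n} \<Longrightarrow> coords U V X $$ p = coords U V Y $$ p"
  shows "X = Y"
proof -
  have "coords U V X = coords U V Y"
    using assms(3) carrier_matD[OF coords_carrier[OF assms(1)]] carrier_matD[OF coords_carrier[OF assms(2)]]
    by (intro eq_matI) auto
  then show ?thesis using of_coords_coords assms(1,2) by metis
qed

lemma of_coords_add:
  assumes "M \<in> carrier_mat n n" "N \<in> carrier_mat n n"
  shows "of_coords U V (M + N) = of_coords U V M + of_coords U V N"
  by (rule coords_eqI) (use assms in \<open>auto simp: coords_add\<close>)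

lemma of_coords_smult:
  assumes "M \<in> carrier_mat n n"
  shows "of_coords U V (c \<cdot>\<^sub>m M) = c \<cdot>\<^sub>m of_coords U V M"
  by (rule coords_eqI) (use assms in \<open>auto simp: coords_smult\<close>)

lemma hs_inner_coords:
  assumes X: "X \<in> carrier_mat n n" and Y: "Y \<in> carrier_mat n n"
  shows "hs_inner X Y = (\<Sum>p\<in>{..<n} \<times> {..<n}. cnj (coords U V X $$ p) * coords U V Y $$ p)"
proof -
  note Ud = unitary_matD[OF U] and Vd = unitary_matD[OF V]
  have XYV: "cadj X * Y * V \<in> carrier_mat n n" using X Y Vd(1) by auto
  have "hs_inner (coords U V X) (coords U V Y) = mtrace (cadj V * (cadj X * (U * cadj U) * Y * V))"
    using X Y Ud(1) Vd(1) by (simp add: hs_inner_def coords_def cadj_mult mult_mat_assoc)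
  also have "\<dots> = mtrace (cadj V * (cadj X * Y * V))"
    using X Ud(4) by simp
  also have "\<dots> = mtrace (cadj X * Y * V * cadj V)"
    by (rule mtrace_mult_comm[OF Vd(2) XYV])
  also have "cadj X * Y * V * cadj V = cadj X * Y * (V * cadj V)"
    using X Y Vd(1) by (simp add: mult_mat_assoc)
  also have "mtrace \<dots> = hs_inner X Y"
    using X Y Vd(4) by (simp add: hs_inner_def mult_mat_assoc)
  finally show ?thesis
    using hs_inner_sum[OF coords_carrier[OF X] coords_carrier[OF Y]] by simp
qed

lemma coords_mult_left:
  assumes D: "D \<in> carrier_mat n n" "hermitian D" "D * U = U * rdiag n d"
    and X: "X \<in> carrier_mat n n" and ij: "i < n" "j < n"
  shows "coords U V (D * X) $$ (i, j) = complex_of_real (d i) * coords U V X $$ (i, j)"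
proof -
  note Ud = unitary_matD[OF U] and Vd = unitary_matD[OF V]
  have "cadj (D * U) = cadj (U * rdiag n d)" using D(3) by simp
  then have UD: "cadj U * D = rdiag n d * cadj U"
    using D(1,2) Ud(1) by (simp add: cadj_mult hermitian_def)
  have "coords U V (D * X) = cadj U * D * X * V"
    using D(1) X Ud(1) Vd(1) by (simp add: coords_def mult_mat_assoc)
  also have "\<dots> = rdiag n d * coords U V X"
    unfolding UD using X Ud(1) Vd(1) by (simp add: coords_def mult_mat_assoc)
  finally show ?thesis using ij by (simp add: mat_diag_mult_left[OF coords_carrier[OF X]])
qed

lemma coords_mult_right:
  assumes D: "D \<in> carrier_mat n n" "D * V = V * rdiag n d"
    and X: "X \<in> carrier_mat n n" and ij: "i < n" "j < n"
  shows "coords U V (X * D) $$ (i, j) = coords U V X $$ (i, j) * complex_of_real (d j)"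
proof -
  note Ud = unitary_matD[OF U] and Vd = unitary_matD[OF V]
  have "coords U V (X * D) = cadj U * X * (D * V)"
    using D(1) X Ud(1) Vd(1) by (simp add: coords_def mult_mat_assoc)
  also have "\<dots> = coords U V X * rdiag n d"
    unfolding D(2) using X Ud(1) Vd(1) by (simp add: coords_def mult_mat_assoc)
  finally show ?thesis using ij by (simp add: mat_diag_mult_right[OF coords_carrier[OF X]])
qed

section \<open>Functional calculus and inverse of operators diagonal in coordinates\<close>

lemma lin_map_eqI:
  assumes S: "lin_map n n S" and S': "lin_map n n S'"
    and eq: "\<And>p. p \<in> {..<n} \<times> {..<n} \<Longrightarrow>
      S (of_coords U V (unit_mat n p)) = S' (of_coords U V (unit_mat n p))"
    and X: "X \<in> carrier_mat n n"
  shows "S X = S' X"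
proof -
  have expand: "R X $$ (a, b) =
      (\<Sum>p\<in>{..<n} \<times> {..<n}. coords U V X $$ p * R (of_coords U V (unit_mat n p)) $$ (a, b))"
    if R: "lin_map n n R" and "a < n" "b < n" for R a b
  proof -
    have Rc: "R Y \<in> carrier_mat n n" if "Y \<in> carrier_mat n n" for Y
      using R that by (simp add: lin_map_def)
    have "R (of_coords U V (coords U V X)) $$ (a, b) =
        (\<Sum>p\<in>{..<n} \<times> {..<n}. coords U V X $$ p * R (of_coords U V (unit_mat n p)) $$ (a, b))"
    proof (rule linear_functional_expand[OF _ _ coords_carrier[OF X],
          of "\<lambda>M. R (of_coords U V M) $$ (a, b)"])
      fix M N :: "complex mat" assume MN: "M \<in> carrier_mat n n" "N \<in> carrier_mat n n"
      then have "R (of_coords U V (M + N)) = R (of_coords U V M) + R (of_coords U V N)"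
        using R by (simp add: lin_map_def of_coords_add)
      then show "R (of_coords U V (M + N)) $$ (a, b)
          = R (of_coords U V M) $$ (a, b) + R (of_coords U V N) $$ (a, b)"
        using Rc[OF of_coords_carrier[OF MN(2)]] that by simp
    next
      fix M :: "complex mat" and c assume M: "M \<in> carrier_mat n n"
      then have "R (of_coords U V (c \<cdot>\<^sub>m M)) = c \<cdot>\<^sub>m R (of_coords U V M)"
        using R by (simp add: lin_map_def of_coords_smult)
      then show "R (of_coords U V (c \<cdot>\<^sub>m M)) $$ (a, b) = c * R (of_coords U V M) $$ (a, b)"
        using Rc[OF of_coords_carrier[OF M]] that by simp
    qed
    then show ?thesis using X by simp
  qed
  have "S X \<in> carrier_mat n n" "S' X \<in> carrier_mat n n" using S S' X by (auto simp: lin_map_def)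
  then show ?thesis
    by (intro eq_matI) (auto simp: expand[OF S] expand[OF S'] eq intro!: sum.cong)
qed

text \<open>The counterpart of \<open>mat_fun_unitary\<close> for operators on matrices. The
  matrices with a single nonzero coordinate are eigenvectors of \<open>T\<close> and form a basis,
  so the prescription in \<open>op_fun\<close> determines a linear map. Conversely, an eigenvector
  of \<open>T\<close> for \<open>c\<close> has coordinates only where \<open>g p = Re c\<close>, so
  the diagonal candidate \<open>S\<close> satisfies the prescription.\<close>

lemma op_fun_coords:
  assumes T: "\<And>X. X \<in> carrier_mat n n \<Longrightarrow> T X \<in> carrier_mat n n"
    and Tc: "\<And>X p. X \<in> carrier_mat n n \<Longrightarrow> p \<in> {..<n} \<times> {..<n} \<Longrightarrow>
      coords U V (T X) $$ p = complex_of_real (g p) * coords U V X $$ p"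
    and X: "X \<in> carrier_mat n n"
  shows "op_fun n f T X \<in> carrier_mat n n"
    and "p \<in> {..<n} \<times> {..<n} \<Longrightarrow>
      coords U V (op_fun n f T X) $$ p = complex_of_real (f (g p)) * coords U V X $$ p"
proof -
  \<comment> \<open>The zero value off the carrier is the one fixed by \<open>op_fun\<close>; it
    makes the solution unique as a total function.\<close>
  define S where "S X = (if X \<in> carrier_mat n n
    then of_coords U V (mat n n (\<lambda>p. complex_of_real (f (g p)) * coords U V X $$ p)) else 0\<^sub>m n n)" for X
  have S: "S X \<in> carrier_mat n n" for X by (simp add: S_def)
  have Sc: "coords U V (S X) $$ p = complex_of_real (f (g p)) * coords U V X $$ p"
    if "X \<in> carrier_mat n n" "p \<in> {..<n} \<times> {..<n}" for X p
    using that by (auto simp: S_def)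
  have linS: "lin_map n n S" unfolding lin_map_def
  proof (intro conjI ballI allI)
    fix X Y :: "complex mat" assume XY: "X \<in> carrier_mat n n" "Y \<in> carrier_mat n n"
    show "S (X + Y) = S X + S Y"
    proof (rule coords_eqI)
      fix p assume p: "p \<in> {..<n} \<times> {..<n}"
      have XY': "X + Y \<in> carrier_mat n n" using XY by simp
      show "coords U V (S (X + Y)) $$ p = coords U V (S X + S Y) $$ p"
        unfolding Sc[OF XY' p] coords_add[OF S S] coords_add[OF XY]
        using p Sc[OF XY(1) p] Sc[OF XY(2) p] coords_carrier[OF XY(2)] coords_carrier[OF S[of Y]]
        by (auto simp: distrib_left)
    qed (use S in auto)
  next
    fix X :: "complex mat" and c assume X: "X \<in> carrier_mat n n"
    show "S (c \<cdot>\<^sub>m X) = c \<cdot>\<^sub>m S X"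
    proof (rule coords_eqI)
      fix p assume p: "p \<in> {..<n} \<times> {..<n}"
      have X': "c \<cdot>\<^sub>m X \<in> carrier_mat n n" using X by simp
      show "coords U V (S (c \<cdot>\<^sub>m X)) $$ p = coords U V (c \<cdot>\<^sub>m S X) $$ p"
        unfolding Sc[OF X' p] coords_smult[OF S] coords_smult[OF X]
        using p Sc[OF X p] coords_carrier[OF X] coords_carrier[OF S[of X]] by auto
    qed (use S in auto)
  qed (rule S)
  have eigS: "S X = complex_of_real (f (Re c)) \<cdot>\<^sub>m X"
    if X: "X \<in> carrier_mat n n" and TX: "T X = c \<cdot>\<^sub>m X" for X c
  proof (rule coords_eqI)
    fix p assume p: "p \<in> {..<n} \<times> {..<n}"
    have "complex_of_real (g p) * coords U V X $$ p = c * coords U V X $$ p"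
      using Tc[OF X p] p coords_carrier[OF X] unfolding TX coords_smult[OF X] by auto
    then have "coords U V X $$ p = 0 \<or> g p = Re c" by auto
    then show "coords U V (S X) $$ p = coords U V (complex_of_real (f (Re c)) \<cdot>\<^sub>m X) $$ p"
      unfolding Sc[OF X p] coords_smult[OF X] using p coords_carrier[OF X] by auto
  qed (use S X in auto)
  have "op_fun n f T = S" unfolding op_fun_def
  proof (rule the_equality)
    show "lin_map n n S \<and>
      (\<forall>X\<in>carrier_mat n n. \<forall>c. T X = c \<cdot>\<^sub>m X \<longrightarrow> S X = complex_of_real (f (Re c)) \<cdot>\<^sub>m X) \<and>
      (\<forall>X. X \<notin> carrier_mat n n \<longrightarrow> S X = 0\<^sub>m n n)"
      using linS eigS by (simp add: S_def)
  next
    fix S' assume S': "lin_map n n S' \<and>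
      (\<forall>X\<in>carrier_mat n n. \<forall>c. T X = c \<cdot>\<^sub>m X \<longrightarrow> S' X = complex_of_real (f (Re c)) \<cdot>\<^sub>m X) \<and>
      (\<forall>X. X \<notin> carrier_mat n n \<longrightarrow> S' X = 0\<^sub>m n n)"
    have unit: "S' E = S E" if p: "p \<in> {..<n} \<times> {..<n}" and E: "E = of_coords U V (unit_mat n p)" for p E
    proof -
      have Ec: "E \<in> carrier_mat n n" by (simp add: E)
      have TE: "T E = complex_of_real (g p) \<cdot>\<^sub>m E"
      proof (rule coords_eqI)
        fix q assume q: "q \<in> {..<n} \<times> {..<n}"
        have "coords U V E = unit_mat n p" by (simp add: E)
        then show "coords U V (T E) $$ q = coords U V (complex_of_real (g p) \<cdot>\<^sub>m E) $$ q"
          unfolding Tc[OF Ec q] coords_smult[OF Ec] using q by (auto simp: unit_mat_def)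
      qed (use T Ec in auto)
      show ?thesis
        unfolding eigS[OF Ec TE]
        by (rule S'[THEN conjunct2, THEN conjunct1, rule_format, OF Ec TE])
    qed
    show "S' = S"
    proof
      fix X
      show "S' X = S X"
        using lin_map_eqI[of S' S X] S' linS unit by (cases "X \<in> carrier_mat n n") (auto simp: S_def)
    qed
  qed
  then show "op_fun n f T X \<in> carrier_mat n n"
    and "p \<in> {..<n} \<times> {..<n} \<Longrightarrow>
      coords U V (op_fun n f T X) $$ p = complex_of_real (f (g p)) * coords U V X $$ p"
    using S Sc X by simp_all
qed

lemma op_inv_coords:
  assumes T: "\<And>X. X \<in> carrier_mat n n \<Longrightarrow> T X \<in> carrier_mat n n"
    and Tc: "\<And>X p. X \<in> carrier_mat n n \<Longrightarrow> p \<in> {..<n} \<times> {..<n} \<Longrightarrow>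
      coords U V (T X) $$ p = complex_of_real (w p) * coords U V X $$ p"
    and w: "\<And>p. p \<in> {..<n} \<times> {..<n} \<Longrightarrow> w p \<noteq> 0"
    and Y: "Y \<in> carrier_mat n n"
  shows "op_inv n T Y \<in> carrier_mat n n"
    and "p \<in> {..<n} \<times> {..<n} \<Longrightarrow>
      coords U V Y $$ p = complex_of_real (w p) * coords U V (op_inv n T Y) $$ p"
proof -
  define Z where "Z = of_coords U V (mat n n (\<lambda>p. coords U V Y $$ p / complex_of_real (w p)))"
  have Z: "Z \<in> carrier_mat n n" by (simp add: Z_def)
  have Zc: "coords U V Z $$ p = coords U V Y $$ p / complex_of_real (w p)"
    if "p \<in> {..<n} \<times> {..<n}" for p
    using that by (auto simp: Z_def)
  have TZ: "T Z = Y"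
    by (rule coords_eqI) (use T Z Y w in \<open>auto simp: Tc Zc\<close>)
  have "op_inv n T Y = Z" unfolding op_inv_def
  proof (rule the_equality)
    fix X assume X: "X \<in> carrier_mat n n \<and> T X = Y"
    show "X = Z"
    proof (rule coords_eqI)
      fix p assume p: "p \<in> {..<n} \<times> {..<n}"
      have "coords U V Y $$ p = complex_of_real (w p) * coords U V X $$ p"
        using Tc[of X p] X p by simp
      then show "coords U V X $$ p = coords U V Z $$ p" using Zc[OF p] w[OF p] by simp
    qed (use X Z in auto)
  qed (use Z TZ in simp)
  then show "op_inv n T Y \<in> carrier_mat n n"
    and "p \<in> {..<n} \<times> {..<n} \<Longrightarrow>
      coords U V Y $$ p = complex_of_real (w p) * coords U V (op_inv n T Y) $$ p"
    using Z Zc w by simp_all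
qed

end

section \<open>Eigenbases of positive definite matrices and the operator J\<close>

definition eigensystem :: "nat \<Rightarrow> complex mat \<Rightarrow> complex mat \<Rightarrow> (nat \<Rightarrow> real) \<Rightarrow> bool" where
  "eigensystem n D U d \<longleftrightarrow> D \<in> carrier_mat n n \<and> hermitian D \<and> unitary_mat n U \<and>
     D * U = U * rdiag n d \<and> (\<forall>i<n. 0 < d i)"

lemma pd_mat_eigensystem:
  assumes "pd_mat n D"
  shows "\<exists>U d. eigensystem n D U d"
proof -
  have D: "D \<in> carrier_mat n n" "hermitian D"
    and pos: "\<And>v. v \<in> carrier_vec n \<Longrightarrow> v \<noteq> 0\<^sub>v n \<Longrightarrow> 0 < Re (qform D v)"
    using assms by (auto simp: pd_mat_def)
  obtain U d where U: "unitary_mat n U" and DU: "D * U = U * rdiag n d"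
    using hermitian_spectral[OF D] by blast
  note Ud = unitary_matD[OF U]
  have "0 < d i" if i: "i < n" for i
  proof -
    define v where "v = col U i"
    have v: "v \<in> carrier_vec n" using Ud(1) i by (simp add: v_def)
    have ns: "(\<Sum>k<n. cnj (v $ k) * v $ k) = 1"
      using Ud(3) mult_mat_index[OF Ud(2,1) i i] Ud(1) i by (simp add: v_def)
    then have v0: "v \<noteq> 0\<^sub>v n" by auto
    have "D *\<^sub>v v = col (U * rdiag n d) i"
      unfolding v_def DU[symmetric] by (rule col_mult2[OF D(1) Ud(1) i, symmetric])
    then have Dv: "(D *\<^sub>v v) $ k = v $ k * complex_of_real (d i)" if "k < n" for k
      using that i Ud(1) by (simp add: mat_diag_mult_right[OF Ud(1)] v_def)
    have "qform D v = (\<Sum>k<n. cnj (v $ k) * v $ k * complex_of_real (d i))"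
      unfolding qform_def using v Dv by (intro sum.cong) (auto simp: mult.assoc simp del: index_mult_mat_vec)
    also have "\<dots> = complex_of_real (d i)" by (simp add: ns flip: sum_distrib_right)
    finally show ?thesis using pos[OF v v0] by simp
  qed
  then show ?thesis using D U DU unfolding eigensystem_def by blast
qed

lemma eigensystem_minv:
  assumes "eigensystem n D U d"
  shows "minv n D \<in> carrier_mat n n" and "minv n D * U = U * rdiag n (\<lambda>i. 1 / d i)"
proof -
  have D: "D \<in> carrier_mat n n" and U: "unitary_mat n U" and DU: "D * U = U * rdiag n d"
    and d: "\<And>i. i < n \<Longrightarrow> 0 < d i"
    using assms by (auto simp: eigensystem_def)
  note Ud = unitary_matD[OF U]
  define E where "E = U * rdiag n (\<lambda>i. 1 / d i) * cadj U"
  have E: "E \<in> carrier_mat n n" using Ud(1) by (auto simp: E_def)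
  have inv: "rdiag n d * rdiag n (\<lambda>i. 1 / d i) = 1\<^sub>m n"
    unfolding mat_diag_diag by (rule eq_matI) (auto simp: mat_diag_def dest: d)
  have "D * E = U * (rdiag n d * rdiag n (\<lambda>i. 1 / d i)) * cadj U"
  proof -
    have "D * E = D * U * rdiag n (\<lambda>i. 1 / d i) * cadj U"
      using D Ud(1) by (simp add: E_def mult_mat_assoc)
    then show ?thesis unfolding DU using Ud(1) by (simp add: mult_mat_assoc del: mat_diag_diag)
  qed
  then have DE: "D * E = 1\<^sub>m n" unfolding inv using Ud by simp
  have ED: "E * D = 1\<^sub>m n" by (rule mat_mult_left_right_inverse[OF D E DE])
  have "minv n D = E" unfolding minv_def
  proof (rule the_equality)
    fix E' assume E': "E' \<in> carrier_mat n n \<and> D * E' = 1\<^sub>m n"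
    then have "E * (D * E') = E" using E by simp
    moreover have "E * (D * E') = E * D * E'" using assoc_mult_mat[OF E D] E' by metis
    moreover have "E * D * E' = E'" unfolding ED using E' by auto
    ultimately show "E' = E" by metis
  qed (use E DE in simp)
  then show "minv n D \<in> carrier_mat n n" and "minv n D * U = U * rdiag n (\<lambda>i. 1 / d i)"
    using E Ud by (simp_all add: E_def mult_mat_assoc)
qed

text \<open>At the coordinate \<open>(i, j)\<close> the map
  \<open>X \<mapsto> D1 * X * minv n D2\<close> has eigenvalue \<open>d i / e j\<close>, and the
  right factor \<open>Rmul D2\<close> contributes \<open>e j\<close>. So the operator multiplies
  that coordinate by the perspective \<open>e j * f (d i / e j)\<close>.\<close>

lemma Jf_coords:
  assumes D1: "eigensystem n D1 U d" and D2: "eigensystem n D2 V e" and X: "X \<in> carrier_mat n n"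
  shows "Jf n f D1 D2 X \<in> carrier_mat n n"
    and "p \<in> {..<n} \<times> {..<n} \<Longrightarrow> coords U V (Jf n f D1 D2 X) $$ p
      = complex_of_real (e (snd p) * f (d (fst p) / e (snd p))) * coords U V X $$ p"
proof -
  have U: "unitary_mat n U" and V: "unitary_mat n V"
    and D1c: "D1 \<in> carrier_mat n n" "hermitian D1" "D1 * U = U * rdiag n d"
    and D2c: "D2 \<in> carrier_mat n n" "D2 * V = V * rdiag n e"
    using D1 D2 by (auto simp: eigensystem_def)
  note M = eigensystem_minv[OF D2]
  have XD: "X * D2 \<in> carrier_mat n n" using X D2c by auto
  define T where "T = Lmul D1 \<circ> Rmul (minv n D2)"
  have T: "T Y \<in> carrier_mat n n" if "Y \<in> carrier_mat n n" for Y
    using that M(1) D1c(1) by (auto simp: T_def Lmul_def Rmul_def)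
  have Tc: "coords U V (T Y) $$ p
      = complex_of_real (d (fst p) / e (snd p)) * coords U V Y $$ p"
    if Y: "Y \<in> carrier_mat n n" and p: "p \<in> {..<n} \<times> {..<n}" for Y p
  proof -
    obtain i j where ij: "p = (i, j)" "i < n" "j < n" using p by auto
    have YM: "Y * minv n D2 \<in> carrier_mat n n" using Y M(1) by auto
    show ?thesis
      using coords_mult_left[OF U V D1c YM ij(2,3)] coords_mult_right[OF U V M Y ij(2,3)]
      by (simp add: ij(1) T_def Lmul_def Rmul_def)
  qed
  have F: "op_fun n f T (X * D2) \<in> carrier_mat n n"
    by (rule op_fun_coords(1)[OF U V _ _ XD]) (fact T, fact Tc)
  have Fc: "coords U V (op_fun n f T (X * D2)) $$ p
      = complex_of_real (f (d (fst p) / e (snd p))) * coords U V (X * D2) $$ p"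
    if "p \<in> {..<n} \<times> {..<n}" for p
    by (rule op_fun_coords(2)[OF U V _ _ XD that]) (fact T, fact Tc)
  have J: "Jf n f D1 D2 X = op_fun n f T (X * D2)"
    by (simp add: Jf_def T_def Rmul_def)
  show "Jf n f D1 D2 X \<in> carrier_mat n n" using F by (simp add: J)
  show "coords U V (Jf n f D1 D2 X) $$ p
      = complex_of_real (e (snd p) * f (d (fst p) / e (snd p))) * coords U V X $$ p"
    if p: "p \<in> {..<n} \<times> {..<n}"
  proof -
    obtain i j where ij: "p = (i, j)" "i < n" "j < n" using p by auto
    show ?thesis
      using Fc[OF p] coords_mult_right[OF U V D2c X ij(2,3)] by (simp add: J ij(1))
  qed
qed

lemma op_inv_Jf_coords:
  assumes D1: "eigensystem n D1 U d" and D2: "eigensystem n D2 V e"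
    and f: "\<forall>x\<ge>0. 0 < f x" and X: "X \<in> carrier_mat n n"
  shows "op_inv n (Jf n f D1 D2) X \<in> carrier_mat n n"
    and "p \<in> {..<n} \<times> {..<n} \<Longrightarrow> coords U V X $$ p
      = complex_of_real (e (snd p) * f (d (fst p) / e (snd p))) * coords U V (op_inv n (Jf n f D1 D2) X) $$ p"
proof -
  have U: "unitary_mat n U" and V: "unitary_mat n V" using D1 D2 by (auto simp: eigensystem_def)
  have nz: "e (snd p) * f (d (fst p) / e (snd p)) \<noteq> 0" if "p \<in> {..<n} \<times> {..<n}" for p
  proof -
    have "0 < d (fst p)" "0 < e (snd p)" using that D1 D2 by (auto simp: eigensystem_def)
    then show ?thesis using f[rule_format, of "d (fst p) / e (snd p)"] by simp
  qed
  note J = Jf_coords[OF D1 D2, where f = f]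
  show "op_inv n (Jf n f D1 D2) X \<in> carrier_mat n n"
    by (rule op_inv_coords(1)[OF U V _ _ _ X]) (fact J(1), fact J(2), fact nz)
  show "coords U V X $$ p
      = complex_of_real (e (snd p) * f (d (fst p) / e (snd p))) * coords U V (op_inv n (Jf n f D1 D2) X) $$ p"
    if "p \<in> {..<n} \<times> {..<n}"
    by (rule op_inv_coords(2)[OF U V _ _ _ X that]) (fact J(1), fact J(2), fact nz)
qed

section \<open>Monotonicity\<close>

text \<open>This is \<open>\<beta> J \<beta>\<^sup>* \<le> J'\<close> evaluated at \<open>Y\<close>.
  It is \<open>operator_monotone_weighted\<close> with weights \<open>p\<close>, \<open>r\<close>
  the eigenvalues of \<open>D2\<close>, \<open>D1\<close> and \<open>q\<close>, \<open>s\<close>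
  those of \<open>\<beta> D2\<close>, \<open>\<beta> D1\<close>; its hypotheses \<open>pq\<close>
  and \<open>rs\<close> are the right and the left Schwarz inequality.\<close>

lemma Jf_adjoint_le:
  assumes cp: "completely_positive n m \<beta>" and tp: "trace_preserving n \<beta>"
    and f: "operator_monotone f" and f0: "0 \<le> f 0"
    and psd: "psd_mat n D1" "psd_mat n D2"
    and D1: "eigensystem n D1 U d" and D2: "eigensystem n D2 V e"
    and B1: "eigensystem m (\<beta> D1) U' d'" and B2: "eigensystem m (\<beta> D2) V' e'"
    and Y: "Y \<in> carrier_mat m m"
  shows "(\<Sum>p\<in>{..<n} \<times> {..<n}. e (snd p) * f (d (fst p) / e (snd p)) *
        (cmod (coords U V (hs_adjoint n m \<beta> Y) $$ p))\<^sup>2)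
    \<le> (\<Sum>q\<in>{..<m} \<times> {..<m}. e' (snd q) * f (d' (fst q) / e' (snd q)) *
        (cmod (coords U' V' Y $$ q))\<^sup>2)"
proof -
  have lin: "lin_map n m \<beta>" using cp by (simp add: completely_positive_def)
  have U: "unitary_mat n U" and V: "unitary_mat n V" and U': "unitary_mat m U'" and V': "unitary_mat m V'"
    using D1 D2 B1 B2 by (auto simp: eigensystem_def)
  have wsq: "Re (cnj z * (complex_of_real c * z)) = c * (cmod z)\<^sup>2" for c z
    unfolding cmod_power2 by (simp add: power2_eq_square algebra_simps)
  have left: "Re (hs_inner X (D * X)) = (\<Sum>p\<in>{..<k} \<times> {..<k}. d (fst p) * (cmod (coords U V X $$ p))\<^sup>2)"
    if D: "eigensystem k D U d" and V: "unitary_mat k V" and X: "X \<in> carrier_mat k k" for k D U V d X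
  proof -
    have U: "unitary_mat k U" and Dc: "D \<in> carrier_mat k k" "hermitian D" "D * U = U * rdiag k d"
      using D by (auto simp: eigensystem_def)
    have DX: "D * X \<in> carrier_mat k k" using Dc X by auto
    show ?thesis unfolding hs_inner_coords[OF U V X DX] Re_sum
      by (intro sum.cong refl)
        (auto simp: coords_mult_left[OF U V Dc X] wsq simp del: times_complex.sel)
  qed
  have right: "Re (hs_inner X (X * D)) = (\<Sum>p\<in>{..<k} \<times> {..<k}. d (snd p) * (cmod (coords U V X $$ p))\<^sup>2)"
    if D: "eigensystem k D V d" and U: "unitary_mat k U" and X: "X \<in> carrier_mat k k" for k D U V d X
  proof -
    have V: "unitary_mat k V" and Dc: "D \<in> carrier_mat k k" "D * V = V * rdiag k d"
      using D by (auto simp: eigensystem_def)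
    have XD: "X * D \<in> carrier_mat k k" using Dc X by auto
    show ?thesis unfolding hs_inner_coords[OF U V X XD] Re_sum
      by (intro sum.cong refl)
        (auto simp: coords_mult_right[OF U V Dc X] mult.commute[of _ "complex_of_real _"] wsq
          simp del: times_complex.sel)
  qed
  \<comment> \<open>The matrix of \<open>\<beta>\<^sup>*\<close> from the eigenbasis coordinates on
    the \<open>m\<close> side to those on the \<open>n\<close> side.\<close>
  define L where "L p q = coords U V (hs_adjoint n m \<beta> (of_coords U' V' (unit_mat m q))) $$ p" for p q
  \<comment> \<open>The weighted inequality quantifies over arbitrary coordinate functions
    \<open>y\<close>; each is realized by a matrix to which the Schwarz inequalities apply.\<close>
  define M where "M y = of_coords U' V' (mat m m y)" for y :: "nat \<times> nat \<Rightarrow> complex"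
  have M: "M y \<in> carrier_mat m m" for y using U' V' by (simp add: M_def)
  have adjM: "hs_adjoint n m \<beta> (M y) \<in> carrier_mat n n" for y by (rule hs_adjoint(1)[OF lin M])
  have coordsM: "coords U' V' (M y) $$ q = y q" if "q \<in> {..<m} \<times> {..<m}" for y q
    using that U' V' by (auto simp: M_def)
  have L: "(\<Sum>q\<in>{..<m} \<times> {..<m}. L p q * y q) = coords U V (hs_adjoint n m \<beta> (M y)) $$ p"
    if p: "p \<in> {..<n} \<times> {..<n}" for p y
  proof -
    note linA = hs_adjoint_lin_map[OF lin]
    have Ac: "hs_adjoint n m \<beta> X \<in> carrier_mat n n" if "X \<in> carrier_mat m m" for X
      by (rule hs_adjoint(1)[OF lin that])
    have "coords U V (hs_adjoint n m \<beta> (of_coords U' V' (mat m m y))) $$ p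
        = (\<Sum>q\<in>{..<m} \<times> {..<m}. mat m m y $$ q * L p q)"
      unfolding L_def
    proof (rule linear_functional_expand[of m "\<lambda>M. coords U V (hs_adjoint n m \<beta> (of_coords U' V' M)) $$ p"])
      fix A B :: "complex mat" assume AB: "A \<in> carrier_mat m m" "B \<in> carrier_mat m m"
      let ?A = "hs_adjoint n m \<beta> (of_coords U' V' A)" and ?B = "hs_adjoint n m \<beta> (of_coords U' V' B)"
      have AB': "?A \<in> carrier_mat n n" "?B \<in> carrier_mat n n" using AB U' V' by (auto intro!: Ac)
      have "hs_adjoint n m \<beta> (of_coords U' V' (A + B)) = ?A + ?B"
        using linA AB U' V' by (simp add: lin_map_def of_coords_add)
      then show "coords U V (hs_adjoint n m \<beta> (of_coords U' V' (A + B))) $$ p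
          = coords U V ?A $$ p + coords U V ?B $$ p"
        using p carrier_matD[OF coords_carrier[OF U V AB'(2)]] by (auto simp: coords_add[OF U V AB'])
    next
      fix A :: "complex mat" and c assume A: "A \<in> carrier_mat m m"
      let ?A = "hs_adjoint n m \<beta> (of_coords U' V' A)"
      have A': "?A \<in> carrier_mat n n" using A U' V' by (auto intro!: Ac)
      have "hs_adjoint n m \<beta> (of_coords U' V' (c \<cdot>\<^sub>m A)) = c \<cdot>\<^sub>m ?A"
        using linA A U' V' by (simp add: lin_map_def of_coords_smult)
      then show "coords U V (hs_adjoint n m \<beta> (of_coords U' V' (c \<cdot>\<^sub>m A))) $$ p = c * coords U V ?A $$ p"
        using p carrier_matD[OF coords_carrier[OF U V A']] by (auto simp: coords_smult[OF U V A'])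
    qed simp
    also have "\<dots> = (\<Sum>q\<in>{..<m} \<times> {..<m}. L p q * y q)" by (intro sum.cong refl) auto
    finally show ?thesis by (simp add: M_def)
  qed
  have "(\<Sum>p\<in>{..<n} \<times> {..<n}. e (snd p) * f (d (fst p) / e (snd p)) *
        (cmod (\<Sum>q\<in>{..<m} \<times> {..<m}. L p q * coords U' V' Y $$ q))\<^sup>2)
    \<le> (\<Sum>q\<in>{..<m} \<times> {..<m}. e' (snd q) * f (d' (fst q) / e' (snd q)) *
        (cmod (coords U' V' Y $$ q))\<^sup>2)"
  proof (rule operator_monotone_weighted[OF f f0])
    fix y :: "nat \<times> nat \<Rightarrow> complex"
    show "(\<Sum>p\<in>{..<n} \<times> {..<n}. e (snd p) * (cmod (\<Sum>q\<in>{..<m} \<times> {..<m}. L p q * y q))\<^sup>2)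
        \<le> (\<Sum>q\<in>{..<m} \<times> {..<m}. e' (snd q) * (cmod (y q))\<^sup>2)"
      using adjoint_Schwarz_right[OF cp tp psd(2) M[of y]]
      unfolding right[OF D2 U adjM] right[OF B2 U' M] by (simp add: L coordsM)
    show "(\<Sum>p\<in>{..<n} \<times> {..<n}. d (fst p) * (cmod (\<Sum>q\<in>{..<m} \<times> {..<m}. L p q * y q))\<^sup>2)
        \<le> (\<Sum>q\<in>{..<m} \<times> {..<m}. d' (fst q) * (cmod (y q))\<^sup>2)"
      using adjoint_Schwarz_left[OF cp tp psd(1) M[of y]]
      unfolding left[OF D1 V adjM] left[OF B1 V' M] by (simp add: L coordsM)
  qed (use D1 D2 B1 B2 in \<open>auto simp: eigensystem_def less_imp_le\<close>)
  moreover have "M (\<lambda>q. coords U' V' Y $$ q) = Y"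
    by (rule coords_eqI[OF U' V' M Y]) (rule coordsM)
  ultimately show ?thesis by (simp add: L)
qed

lemma pd_imp_psd_mat: "pd_mat n D \<Longrightarrow> psd_mat n D"
proof -
  assume D: "pd_mat n D"
  have "0 \<le> Re (qform D v)" if "v \<in> carrier_vec n" for v
    using D that by (cases "v = 0\<^sub>v n") (auto simp: pd_mat_def qform_def less_imp_le)
  then show ?thesis using D by (simp add: pd_mat_def psd_mat_def)
qed

theorem theorem5:
  fixes n m :: nat and \<beta> :: "complex mat \<Rightarrow> complex mat"
    and f :: "real \<Rightarrow> real" and D1 D2 :: "complex mat"
  assumes "completely_positive n m \<beta>" and "trace_preserving n \<beta>"
    and "operator_monotone f" and "\<forall>x\<ge>0. f x > 0"
    and "pd_mat n D1" and "pd_mat n D2"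
    and "pd_mat m (\<beta> D1)" and "pd_mat m (\<beta> D2)"
  shows "op_le n (hs_adjoint n m \<beta> \<circ> op_inv m (Jf m f (\<beta> D1) (\<beta> D2)) \<circ> \<beta>)
                 (op_inv n (Jf n f D1 D2))"
proof -
  obtain U d V e U' d' V' e' where D1: "eigensystem n D1 U d" and D2: "eigensystem n D2 V e"
    and B1: "eigensystem m (\<beta> D1) U' d'" and B2: "eigensystem m (\<beta> D2) V' e'"
    using assms(5-8)[THEN pd_mat_eigensystem] by blast
  have lin: "lin_map n m \<beta>" using assms(1) by (simp add: completely_positive_def)
  have U: "unitary_mat n U" and V: "unitary_mat n V" and U': "unitary_mat m U'" and V': "unitary_mat m V'"
    using D1 D2 B1 B2 by (auto simp: eigensystem_def)
  define w where "w p = e (snd p) * f (d (fst p) / e (snd p))" for p :: "nat \<times> nat"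
  define w' where "w' q = e' (snd q) * f (d' (fst q) / e' (snd q))" for q :: "nat \<times> nat"
  have w: "0 < w p" if "p \<in> {..<n} \<times> {..<n}" for p
  proof -
    have "0 < d (fst p)" "0 < e (snd p)" using that D1 D2 by (auto simp: eigensystem_def)
    then show ?thesis using assms(4) by (simp add: w_def less_imp_le)
  qed
  have w': "0 < w' q" if "q \<in> {..<m} \<times> {..<m}" for q
  proof -
    have "0 < d' (fst q)" "0 < e' (snd q)" using that B1 B2 by (auto simp: eigensystem_def)
    then show ?thesis using assms(4) by (simp add: w'_def less_imp_le)
  qed
  show ?thesis unfolding op_le_def
  proof
    fix X :: "complex mat" assume X: "X \<in> carrier_mat n n"
    have \<beta>X: "\<beta> X \<in> carrier_mat m m" using lin X by (simp add: lin_map_def)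
    define R where "R = op_inv n (Jf n f D1 D2) X"
    define Y where "Y = op_inv m (Jf m f (\<beta> D1) (\<beta> D2)) (\<beta> X)"
    define W where "W = hs_adjoint n m \<beta> Y"
    note R = op_inv_Jf_coords(1)[OF D1 D2 assms(4) X, folded R_def]
      and Rc = op_inv_Jf_coords(2)[OF D1 D2 assms(4) X, folded R_def w_def]
      and Y = op_inv_Jf_coords(1)[OF B1 B2 assms(4) \<beta>X, folded Y_def]
      and Yc = op_inv_Jf_coords(2)[OF B1 B2 assms(4) \<beta>X, folded Y_def w'_def]
    have W: "W \<in> carrier_mat n n" unfolding W_def by (rule hs_adjoint(1)[OF lin Y])
    let ?x = "\<lambda>p. coords U V X $$ p" and ?W = "\<lambda>p. coords U V W $$ p"
    \<comment> \<open>\<open>N\<close> is the quadratic form of the inverse of \<open>J\<close> at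
      \<open>X\<close>, and \<open>Q\<close> that of \<open>J'\<close> at \<open>Y\<close>. Because
      \<open>J' Y = \<beta> X\<close>, \<open>Q\<close> also equals \<open>hs_inner X W\<close>, the
      left operator's form at \<open>X\<close>. Both numbers are real, which settles the imaginary
      part.\<close>
    define N where "N = (\<Sum>p\<in>{..<n} \<times> {..<n}. (cmod (?x p))\<^sup>2 / w p)"
    define Q where "Q = (\<Sum>q\<in>{..<m} \<times> {..<m}. w' q * (cmod (coords U' V' Y $$ q))\<^sup>2)"
    have N0: "0 \<le> N" unfolding N_def using w by (intro sum_nonneg) (auto simp: less_imp_le)
    have Q0: "0 \<le> Q" unfolding Q_def using w' by (intro sum_nonneg) (auto simp: less_imp_le)
    have XR: "hs_inner X R = complex_of_real N"
      unfolding hs_inner_coords[OF U V X R] N_def of_real_sum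
    proof (intro sum.cong refl)
      fix p assume p: "p \<in> {..<n} \<times> {..<n}"
      then have "coords U V R $$ p = ?x p / complex_of_real (w p)" using Rc w[OF p] by simp
      then show "cnj (?x p) * coords U V R $$ p = complex_of_real ((cmod (?x p))\<^sup>2 / w p)"
        by (simp only: of_real_divide complex_norm_square) (simp add: mult.commute)
    qed
    have XW: "hs_inner X W = complex_of_real Q"
    proof -
      have "hs_inner W X = hs_inner Y (\<beta> X)" unfolding W_def by (rule hs_adjoint(2)[OF lin Y X])
      also have "\<dots> = complex_of_real Q"
        unfolding hs_inner_coords[OF U' V' Y \<beta>X] Q_def of_real_sum
        by (intro sum.cong refl) (simp only: Yc of_real_mult complex_norm_square mult_ac)
      finally show ?thesis using hs_inner_cnj[OF W X] by simp
    qed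
    have WQ: "(\<Sum>p\<in>{..<n} \<times> {..<n}. w p * (cmod (?W p))\<^sup>2) \<le> Q"
      unfolding W_def w_def Q_def w'_def
      using Jf_adjoint_le[OF assms(1-3) _ assms(5,6)[THEN pd_imp_psd_mat] D1 D2 B1 B2 Y] assms(4)
      by (simp add: less_imp_le)
    \<comment> \<open>Cauchy-Schwarz for \<open>hs_inner X W\<close> with weights
      \<open>1 / w\<close> on \<open>X\<close> and \<open>w\<close> on \<open>W\<close>. The second
      factor is the form of \<open>J\<close> at \<open>W\<close>, which \<open>WQ\<close> bounds by
      \<open>Q\<close> again.\<close>
    have "Q\<^sup>2 \<le> N * Q"
    proof -
      let ?g = "\<lambda>p. cnj (?x p) / complex_of_real (sqrt (w p))"
      let ?h = "\<lambda>p. complex_of_real (sqrt (w p)) * ?W p"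
      have XW': "hs_inner X W = (\<Sum>p\<in>{..<n} \<times> {..<n}. ?g p * ?h p)"
        unfolding hs_inner_coords[OF U V X W] using less_imp_neq[OF w]
        by (intro sum.cong refl) (simp add: eq_commute[of 0])
      have "Q\<^sup>2 = (cmod (\<Sum>p\<in>{..<n} \<times> {..<n}. ?g p * ?h p))\<^sup>2"
        unfolding XW'[symmetric] XW by simp
      also have "\<dots> \<le> (\<Sum>p\<in>{..<n} \<times> {..<n}. (cmod (?g p))\<^sup>2) * (\<Sum>p\<in>{..<n} \<times> {..<n}. (cmod (?h p))\<^sup>2)"
        by (rule norm_sum_mult_squared_le)
      also have "(\<Sum>p\<in>{..<n} \<times> {..<n}. (cmod (?g p))\<^sup>2) = N"
        unfolding N_def using w
        by (intro sum.cong refl) (simp add: norm_divide power_divide less_imp_le)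
      also have "(\<Sum>p\<in>{..<n} \<times> {..<n}. (cmod (?h p))\<^sup>2) = (\<Sum>p\<in>{..<n} \<times> {..<n}. w p * (cmod (?W p))\<^sup>2)"
        using w by (intro sum.cong refl) (simp add: norm_mult power_mult_distrib less_imp_le)
      also have "N * \<dots> \<le> N * Q" using N0 WQ by (rule mult_left_mono[rotated])
      finally show ?thesis .
    qed
    then have "Q \<le> N" using N0 Q0
      by (cases "Q = 0") (auto simp: power2_eq_square)
    then show "Im (hs_inner X (op_inv n (Jf n f D1 D2) X -
          (hs_adjoint n m \<beta> \<circ> op_inv m (Jf m f (\<beta> D1) (\<beta> D2)) \<circ> \<beta>) X)) = 0 \<and>
        0 \<le> Re (hs_inner X (op_inv n (Jf n f D1 D2) X -
          (hs_adjoint n m \<beta> \<circ> op_inv m (Jf m f (\<beta> D1) (\<beta> D2)) \<circ> \<beta>) X))"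
      using hs_inner_minus_right[OF X R W] XR XW by (simp add: R_def W_def Y_def)
  qed
qed

end
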